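(* Let $n\ge1$ and $0\le r\le n$ be integers and let $\Lambda=(\lambda_{i,j})\in M_n(k^* )$ be multiplicatively antisymmetric. Then: 1. $G(\operatorname{Frac}(S_{n,r}^{\Lambda}(k)))=\langle\lambda_{i,j}\rangle$, the subgroup of $k^*$ generated by the $\lambda_{i,j}$; 2. $E(\operatorname{Frac}(S_{n,r}^{\Lambda}(k)))=k$ as soon as $r\ge1$, and $E(\operatorname{Frac}(S_{n,0}^{\Lambda}(k)))=0$.
   Context: $k$ is a field of characteristic $0$. For a $k$-algebra $A$: $G(A)=(A^* )'\cap k^*$, the trace on $k^*$ of the derived (commutator) subgroup of the multiplicative group $A^*$ of units of $A$; $E(A)=[A,A]\cap k$, the trace on $k$ of the derived Lie algebra $[A,A]$ of $A$. A matrix $\Lambda=(\lambda_{i,j})\in M_n(k^* )$ is multiplicatively antisymmetric if $\lambda_{i,j}\lambda_{j,i}=\lambda_{i,i}=1$ for all $i,j$. For integers $n\ge1$, $0\le r\le n$ and such a $\Lambda$, $S_{n,r}^{\Lambda}(k)$ is the $k$-algebra generated by $y_1,\dots,y_n,x_1,\dots,x_r$ with relations: $y_iy_j=\lambda_{i,j}y_jy_i$ ($1\le i,j\le n$); $x_iy_i=y_ix_i+1$ ($1\le i\le r$); $x_iy_j=\lambda_{i,j}^{-1}y_jx_i$ ($1\le i\le r$, $1\le j\le n$, $i\ne j$); $x_ix_j=\lambda_{i,j}x_jx_i$ ($1\le i,j\le r$). It is a noetherian domain (an iterated Ore extension) and $\operatorname{Frac}$ denotes its skew field of fractions. *)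

theory Defs
  imports "HOL-Algebra.QuotRing" "HOL-Algebra.Generated_Groups" "HOL-Library.Poly_Mapping"
begin

text \<open>
  The free algebra is built from finitely supported functions on words; the product of
  \<open>poly_mapping\<close> is convolution with respect to \<open>+\<close> on the index type, so words are
  given concatenation as (noncommutative) addition.
\<close>

instantiation list :: (type) monoid_add
begin

definition zero_list :: "'a list" where "zero_list = []"

definition plus_list :: "'a list \<Rightarrow> 'a list \<Rightarrow> 'a list" where "plus_list = (@)"

instance by standard (simp_all add: zero_list_def plus_list_def)

end

definition univ_ring :: "'a::ring_1 ring" where
  "univ_ring = \<lparr>carrier = UNIV, monoid.mult = (*), monoid.one = 1, ring.zero = 0, ring.add = (+)\<rparr>"

definition free_algebra :: "'g set \<Rightarrow> ('g list \<Rightarrow>\<^sub>0 'k::field) ring" where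
  "free_algebra G =
     \<lparr>carrier = {p. Poly_Mapping.keys p \<subseteq> lists G},
      monoid.mult = (*), monoid.one = 1, ring.zero = 0, ring.add = (+)\<rparr>"

definition scalar :: "'k::field \<Rightarrow> ('g list \<Rightarrow>\<^sub>0 'k)" where
  "scalar c = Poly_Mapping.single [] c"

definition gen :: "'g \<Rightarrow> ('g list \<Rightarrow>\<^sub>0 'k::field)" where
  "gen g = Poly_Mapping.single [g] 1"


definition mult_antisymmetric :: "nat \<Rightarrow> (nat \<Rightarrow> nat \<Rightarrow> 'k::field) \<Rightarrow> bool" where
  "mult_antisymmetric n \<Lambda> \<longleftrightarrow>
     (\<forall>i\<in>{1..n}. \<forall>j\<in>{1..n}. \<Lambda> i j \<noteq> 0 \<and> \<Lambda> i j * \<Lambda> j i = 1 \<and> \<Lambda> i i = 1)"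

datatype generator = Gen_y nat | Gen_x nat

definition S_gens :: "nat \<Rightarrow> nat \<Rightarrow> generator set" where
  "S_gens n r = Gen_y ` {1..n} \<union> Gen_x ` {1..r}"

abbreviation y_gen :: "nat \<Rightarrow> (generator list \<Rightarrow>\<^sub>0 'k::field)" where "y_gen i \<equiv> gen (Gen_y i)"

abbreviation x_gen :: "nat \<Rightarrow> (generator list \<Rightarrow>\<^sub>0 'k::field)" where "x_gen i \<equiv> gen (Gen_x i)"

definition S_relators ::
    "nat \<Rightarrow> nat \<Rightarrow> (nat \<Rightarrow> nat \<Rightarrow> 'k::field) \<Rightarrow> (generator list \<Rightarrow>\<^sub>0 'k) set" where
  "S_relators n r \<Lambda> =
     {y_gen i * y_gen j - scalar (\<Lambda> i j) * y_gen j * y_gen i | i j. i \<in> {1..n} \<and> j \<in> {1..n}} \<union>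
     {x_gen i * y_gen i - (y_gen i * x_gen i + 1) | i. i \<in> {1..r}} \<union>
     {x_gen i * y_gen j - scalar (inverse (\<Lambda> i j)) * y_gen j * x_gen i | i j. i \<in> {1..r} \<and> j \<in> {1..n} \<and> i \<noteq> j} \<union>
     {x_gen i * x_gen j - scalar (\<Lambda> i j) * x_gen j * x_gen i | i j. i \<in> {1..r} \<and> j \<in> {1..r}}"

definition S_ideal ::
    "nat \<Rightarrow> nat \<Rightarrow> (nat \<Rightarrow> nat \<Rightarrow> 'k::field) \<Rightarrow> (generator list \<Rightarrow>\<^sub>0 'k) set" where
  "S_ideal n r \<Lambda> = genideal (free_algebra (S_gens n r)) (S_relators n r \<Lambda>)"

definition S_alg ::
    "nat \<Rightarrow> nat \<Rightarrow> (nat \<Rightarrow> nat \<Rightarrow> 'k::field) \<Rightarrow> (generator list \<Rightarrow>\<^sub>0 'k) set ring" where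
  "S_alg n r \<Lambda> = free_algebra (S_gens n r) Quot S_ideal n r \<Lambda>"

definition S_scalar ::
    "nat \<Rightarrow> nat \<Rightarrow> (nat \<Rightarrow> nat \<Rightarrow> 'k::field) \<Rightarrow> 'k \<Rightarrow> (generator list \<Rightarrow>\<^sub>0 'k) set" where
  "S_scalar n r \<Lambda> c = S_ideal n r \<Lambda> +>\<^bsub>free_algebra (S_gens n r)\<^esub> scalar c"


definition skew_field :: "('a, 'm) ring_scheme \<Rightarrow> bool" where
  "skew_field D \<longleftrightarrow> ring D \<and> Units D = carrier D - {\<zero>\<^bsub>D\<^esub>}"

text \<open>
  \<open>D\<close>, with the embedding \<open>\<iota>\<close>, is a skew field of (right) fractions of \<open>R\<close>. For a
  noetherian domain it exists, is unique up to a unique isomorphism compatible with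
  \<open>\<iota>\<close>, and is also the skew field of left fractions.
\<close>

definition skew_field_of_fractions ::
    "('a, 'm) ring_scheme \<Rightarrow> ('d, 'n) ring_scheme \<Rightarrow> ('a \<Rightarrow> 'd) \<Rightarrow> bool" where
  "skew_field_of_fractions R D \<iota> \<longleftrightarrow>
     skew_field D \<and> \<iota> \<in> ring_hom R D \<and> inj_on \<iota> (carrier R) \<and>
     (\<forall>d\<in>carrier D. \<exists>a\<in>carrier R. \<exists>b\<in>carrier R - {\<zero>\<^bsub>R\<^esub>}. d = \<iota> a \<otimes>\<^bsub>D\<^esub> inv\<^bsub>D\<^esub> (\<iota> b))"


text \<open>
  A \<open>k\<close>-algebra is a ring \<open>A\<close> together with its structure map \<open>\<eta>\<close> from \<open>k\<close> to the centre of
  \<open>A\<close>; the intersections with \<open>k\<close> and \<open>k\<^sup>*\<close> are expressed as preimages under \<open>\<eta>\<close>.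
\<close>

definition G_trace :: "('a, 'm) ring_scheme \<Rightarrow> ('k::field \<Rightarrow> 'a) \<Rightarrow> 'k set" where
  "G_trace A \<eta> = {c. c \<noteq> 0 \<and> \<eta> c \<in> derived (units_of A) (Units A)}"

text \<open>The \<open>k\<close>-linear span of the additive commutators.\<close>

definition lie_derived :: "('a, 'm) ring_scheme \<Rightarrow> ('k::field \<Rightarrow> 'a) \<Rightarrow> 'a set" where
  "lie_derived A \<eta> = generate (add_monoid A)
     {\<eta> c \<otimes>\<^bsub>A\<^esub> (a \<otimes>\<^bsub>A\<^esub> b \<ominus>\<^bsub>A\<^esub> b \<otimes>\<^bsub>A\<^esub> a) | c a b. a \<in> carrier A \<and> b \<in> carrier A}"

definition E_trace :: "('a, 'm) ring_scheme \<Rightarrow> ('k::field \<Rightarrow> 'a) \<Rightarrow> 'k set" where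
  "E_trace A \<eta> = {c. \<eta> c \<in> lie_derived A \<eta>}"


lemma ring_univ_ring: "ring (univ_ring :: 'a::ring_1 ring)"
  by (rule ringI)
    (auto simp: univ_ring_def algebra_simps intro!: abelian_groupI monoidI
      exI[of _ "- x" for x] intro: add.right_inverse add.left_inverse)

lemma free_algebra_mult_closed:
  fixes p q :: "'g list \<Rightarrow>\<^sub>0 'k::field"
  assumes "Poly_Mapping.keys p \<subseteq> lists G" "Poly_Mapping.keys q \<subseteq> lists G"
  shows "Poly_Mapping.keys (p * q) \<subseteq> lists G"
  using keys_mult[of p q] assms by (fastforce simp: plus_list_def)

lemma free_algebra_add_closed:
  fixes p q :: "'g list \<Rightarrow>\<^sub>0 'k::field"
  assumes "Poly_Mapping.keys p \<subseteq> lists G" "Poly_Mapping.keys q \<subseteq> lists G"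
  shows "Poly_Mapping.keys (p + q) \<subseteq> lists G"
  using Poly_Mapping.keys_add[of p q] assms by blast

lemma ring_free_algebra: "ring (free_algebra G :: ('g list \<Rightarrow>\<^sub>0 'k::field) ring)"
proof (rule ringI)
  show "abelian_group (free_algebra G :: ('g list \<Rightarrow>\<^sub>0 'k) ring)"
  proof (rule abelian_groupI)
    fix p :: "'g list \<Rightarrow>\<^sub>0 'k"
    assume "p \<in> carrier (free_algebra G)"
    then show "\<exists>q\<in>carrier (free_algebra G). q \<oplus>\<^bsub>free_algebra G\<^esub> p = \<zero>\<^bsub>free_algebra G\<^esub>"
      by (intro bexI[of _ "- p"]) (auto simp: free_algebra_def)
  qed (auto simp: free_algebra_def algebra_simps dest: free_algebra_add_closed[THEN subsetD, rotated 2])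
  show "Group.monoid (free_algebra G :: ('g list \<Rightarrow>\<^sub>0 'k) ring)"
    by (rule monoidI)
      (auto simp: free_algebra_def algebra_simps zero_list_def
        dest: free_algebra_mult_closed[THEN subsetD, rotated 2])
qed (auto simp: free_algebra_def algebra_simps)

lemma S_relators_subset:
  assumes "r \<le> n"
  shows "S_relators n r \<Lambda> \<subseteq> carrier (free_algebra (S_gens n r))"
proof -
  let ?C = "\<lambda>p :: generator list \<Rightarrow>\<^sub>0 'a. Poly_Mapping.keys p \<subseteq> lists (S_gens n r)"
  have diff: "?C (p - q)" if "?C p" "?C q" for p q
    using that free_algebra_add_closed[of p "S_gens n r" "- q"] by simp
  have g: "?C (gen g)" if "g \<in> S_gens n r" for g
    using that by (simp add: gen_def)
  have s: "?C (scalar c)" for c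
    by (simp add: scalar_def)
  have one: "?C 1"
    by (simp add: zero_list_def)
  have Gy: "?C (y_gen i)" if "i \<in> {1..n}" for i
    using that by (intro g) (auto simp: S_gens_def)
  have Gx: "?C (x_gen i)" if "i \<in> {1..r}" for i
    using that by (intro g) (auto simp: S_gens_def)
  have r: "i \<in> {1..n}" if "i \<in> {1..r}" for i
    using that assms by auto
  note closed = diff free_algebra_mult_closed free_algebra_add_closed s one Gx Gy
  have 1: "?C (y_gen i * y_gen j - scalar (\<Lambda> i j) * y_gen j * y_gen i)"
    if "i \<in> {1..n}" "j \<in> {1..n}" for i j
    by (intro closed that)
  have 2: "?C (x_gen i * y_gen i - (y_gen i * x_gen i + 1))" if "i \<in> {1..r}" for i
    by (intro closed that r[OF that])
  have 3: "?C (x_gen i * y_gen j - scalar (inverse (\<Lambda> i j)) * y_gen j * x_gen i)"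
    if "i \<in> {1..r}" "j \<in> {1..n}" for i j
    by (intro closed that)
  have 4: "?C (x_gen i * x_gen j - scalar (\<Lambda> i j) * x_gen j * x_gen i)"
    if "i \<in> {1..r}" "j \<in> {1..r}" for i j
    by (intro closed that)
  have "p \<in> S_relators n r \<Lambda> \<Longrightarrow> ?C p" for p
    unfolding S_relators_def using 1 2 3 4 by blast
  then show ?thesis
    by (auto simp: free_algebra_def)
qed

lemma ideal_S_ideal:
  assumes "r \<le> n"
  shows "ideal (S_ideal n r \<Lambda>) (free_algebra (S_gens n r))"
  unfolding S_ideal_def
  by (rule ring.genideal_ideal[OF ring_free_algebra S_relators_subset[OF assms]])

lemma ring_S_alg:
  assumes "r \<le> n"
  shows "ring (S_alg n r \<Lambda>)"
  unfolding S_alg_def by (rule ideal.quotient_is_ring[OF ideal_S_ideal[OF assms]])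

lemma scalar_one: "scalar 1 = 1"
  unfolding scalar_def zero_list_def[symmetric] by (rule single_one)

lemma scalar_ring_hom: "scalar \<in> ring_hom univ_ring (free_algebra G)"
  by (rule ring_hom_memI)
    (auto simp: univ_ring_def free_algebra_def scalar_one,
     auto simp: scalar_def mult_single single_add plus_list_def split: if_splits)

lemma scalar_central: "scalar c * p = p * scalar c"
proof (induction p rule: update_induct)
  case const
  show ?case by simp
next
  case (update p w d)
  have "Poly_Mapping.update w d p = p + Poly_Mapping.single w d"
    using update by (intro poly_mapping_eqI) (auto simp: lookup_update lookup_add lookup_single in_keys_iff)
  then show ?case
    using update.IH by (simp add: algebra_simps scalar_def mult_single plus_list_def)
qed

lemma S_scalar_ring_hom:
  assumes "r \<le> n"
  shows "S_scalar n r \<Lambda> \<in> ring_hom univ_ring (S_alg n r \<Lambda>)"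
  using ring_hom_trans[OF scalar_ring_hom ideal.rcos_ring_hom[OF ideal_S_ideal[OF assms]], of \<Lambda>]
  by (simp add: S_alg_def S_scalar_def[abs_def] comp_def)

end

theory Submission
  imports Defs Complex_Main "HOL-Computational_Algebra.Primes" "HOL-Library.Infinite_Set"
begin

text \<open>
  Order the words in the generators by a weight that is multiplicative and separates words up to
  rearrangement. Every relation exchanges two adjacent letters up to a factor \<open>\<lambda>\<^sub>i\<^sub>j\<close> and terms of
  smaller weight, so modulo the group \<open>L\<close> generated by the \<open>\<lambda>\<^sub>i\<^sub>j\<close> the leading coefficient of a nonzero
  element of \<open>S\<close> is well defined and multiplicative. It extends to a homomorphism from the units of
  \<open>Frac S\<close> to the abelian group \<open>k\<^sup>*/L\<close> that kills commutators and is the projection on \<open>k\<^sup>*\<close>, whence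
  \<open>G(Frac S) \<subseteq> L\<close>. The linear independence of the ordered monomials, on which this rests,
  is seen from the action of \<open>S\<close> by multiplications and twisted derivations.

  The weight of the leading word likewise extends to an ultrametric absolute value on \<open>Frac S\<close>. For
  \<open>r = 0\<close> the Laurent monomials span a dense subring, in which a commutator has no constant term.
  So an element of \<open>[Frac S, Frac S]\<close> is approximated up to an error of norm less than 1 by sums of
  monomials of norm different from 1, which is impossible for a nonzero constant.
\<close>

text \<open>Elements of the skew field have no expansion in monomials, so a constant term of a
  commutator cannot simply be read off. Embedding the skew field into one of series is avoided by
  working with approximations: the absolute value is ultrametric and nonzero constants have norm 1,
  so an error of norm less than 1 cannot hide a constant. The case \<open>r = 0\<close> is special
  because reordering a word is then exact. The Laurent monomials are therefore closed under products
  up to scalars, and monomials of equal norm are proportional. For \<open>r \<ge> 1\<close> the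
  correction term in the relation between \<open>x_i\<close> and \<open>y_i\<close> destroys this,
  and 1 is itself a commutator. No Ore condition is proved for \<open>S\<close>: common multiples
  come from writing elements of the given skew field as right fractions. Characteristic 0 enters
  through the twisted derivations, whose factor \<open>t + 1\<close> must vanish in \<open>k\<close>
  only for \<open>t = -1\<close>.\<close>

lemma mset_eq_swap_induct:
  assumes "mset u = mset v" "u \<in> lists S"
    and refl: "\<And>w. w \<in> lists S \<Longrightarrow> P w w"
    and trans: "\<And>u v w. P u v \<Longrightarrow> P v w \<Longrightarrow> P u w"
    and swap: "\<And>u v g h. u \<in> lists S \<Longrightarrow> v \<in> lists S \<Longrightarrow> g \<in> S \<Longrightarrow> h \<in> S
                 \<Longrightarrow> P (u @ [g, h] @ v) (u @ [h, g] @ v)"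
  shows "P u v"
proof -
  have move: "P (w @ g # a @ b) (w @ a @ g # b)"
    if "w \<in> lists S" "g \<in> S" "a \<in> lists S" "b \<in> lists S" for w g a b
    using that
  proof (induction a arbitrary: w)
    case Nil
    then show ?case by (simp add: refl)
  next
    case (Cons h a)
    have "P (w @ [g, h] @ (a @ b)) (w @ [h, g] @ (a @ b))"
      using Cons.prems by (intro swap) auto
    moreover have "P ((w @ [h]) @ g # a @ b) ((w @ [h]) @ a @ g # b)"
      using Cons.prems by (intro Cons.IH) auto
    ultimately show ?case
      using trans[of "w @ g # (h # a) @ b" "w @ h # g # a @ b" "w @ (h # a) @ g # b"] by simp
  qed
  \<comment> \<open>\<open>P\<close> is not assumed stable under concatenation, so the induction
    carries a prefix \<open>w\<close> along; the first letter of \<open>u\<close> is then brought to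
    its place in \<open>v\<close> by \<open>move\<close>.\<close>
  have "P (w @ u) (w @ v)" if "w \<in> lists S" for w
    using assms(1,2) that
  proof (induction u arbitrary: v w)
    case Nil
    then show ?case by (simp add: refl)
  next
    case (Cons g u)
    have "g \<in> set v"
      using Cons.prems(1) by (metis list.set_intros(1) set_mset_mset)
    then obtain a b where v: "v = a @ g # b"
      by (auto simp: in_set_conv_decomp)
    have ab: "a @ b \<in> lists S"
      using Cons.prems v by (metis Cons_in_lists_iff append_in_lists_conv lists_eq_set mem_Collect_eq set_mset_mset)
    have "P ((w @ [g]) @ u) ((w @ [g]) @ a @ b)"
      using Cons.prems v by (intro Cons.IH) auto
    moreover have "P (w @ g # a @ b) (w @ a @ g # b)"
      using Cons.prems ab by (intro move) auto
    ultimately show ?case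
      using trans[of "w @ g # u" "w @ g # a @ b" "w @ a @ g # b"] v by simp
  qed
  from this[of "[]"] show ?thesis by simp
qed

lemma poly_mapping_monomial_induct [case_names zero single add]:
  assumes "P 0" "\<And>w c. P (Poly_Mapping.single w c)" "\<And>p q. P p \<Longrightarrow> P q \<Longrightarrow> P (p + q)"
  shows "P (p :: 'a \<Rightarrow>\<^sub>0 'b::comm_monoid_add)"
proof (induction p rule: update_induct)
  case const
  show ?case by (rule assms(1))
next
  case (update p w d)
  have "Poly_Mapping.update w d p = p + Poly_Mapping.single w d"
    using update by (intro poly_mapping_eqI) (auto simp: lookup_update lookup_add lookup_single in_keys_iff)
  then show ?case
    using update.IH assms(2,3) by simp
qed

lemma poly_mapping_sum_single:
  fixes p :: "'a \<Rightarrow>\<^sub>0 'b::comm_monoid_add"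
  shows "p = (\<Sum>w\<in>Poly_Mapping.keys p. Poly_Mapping.single w (Poly_Mapping.lookup p w))"
  by (rule poly_mapping_eqI)
    (auto simp: lookup_sum lookup_single when_def sum.delta' in_keys_iff)

section \<open>The multiplicative group of a field\<close>

lemma carrier_units_univ_ring: "carrier (units_of (univ_ring :: 'k::field ring)) = - {0}"
  by (auto simp: units_of_def Units_def univ_ring_def) (metis left_inverse right_inverse)

lemma mult_units_univ_ring: "x \<otimes>\<^bsub>units_of (univ_ring :: 'k::field ring)\<^esub> y = x * y"
  by (simp add: units_of_def univ_ring_def)

lemma one_units_univ_ring: "\<one>\<^bsub>units_of (univ_ring :: 'k::field ring)\<^esub> = 1"
  by (simp add: units_of_def univ_ring_def)

lemma comm_group_units_univ_ring: "comm_group (units_of (univ_ring :: 'k::field ring))"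
proof (rule comm_groupI)
  fix x :: 'k assume "x \<in> carrier (units_of univ_ring)"
  then show "\<exists>y\<in>carrier (units_of univ_ring). y \<otimes>\<^bsub>units_of univ_ring\<^esub> x = \<one>\<^bsub>units_of univ_ring\<^esub>"
    unfolding carrier_units_univ_ring mult_units_univ_ring one_units_univ_ring
    by (intro bexI[of _ "inverse x"]) auto
qed (auto simp: carrier_units_univ_ring mult_units_univ_ring one_units_univ_ring)

lemma inv_units_univ_ring:
  assumes "(x :: 'k::field) \<noteq> 0"
  shows "inv\<^bsub>units_of univ_ring\<^esub> x = inverse x"
proof -
  interpret comm_group "units_of (univ_ring :: 'k ring)" by (rule comm_group_units_univ_ring)
  show ?thesis
    using assms by (intro inv_equality)
      (auto simp: carrier_units_univ_ring mult_units_univ_ring one_units_univ_ring)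
qed

section \<open>Prime weights of words\<close>

definition gen_prime :: "generator \<Rightarrow> nat" where
  "gen_prime g = enumerate {p. prime p} (case g of Gen_y i \<Rightarrow> 2 * i | Gen_x i \<Rightarrow> 2 * i + 1)"

text \<open>
  Logarithmically, the weights of the generators are linearly independent over the rationals,
  so that words of equal weight are rearrangements of each other.
\<close>

definition wt :: "generator list \<Rightarrow> nat" where
  "wt u = prod_list (map gen_prime u)"

lemma prime_gen_prime: "prime (gen_prime g)"
  using enumerate_in_set[OF primes_infinite] by (auto simp: gen_prime_def)

lemma inj_gen_prime: "inj gen_prime"
proof (rule injI)
  fix g h assume "gen_prime g = gen_prime h"
  then have "(case g of Gen_y i \<Rightarrow> 2 * i | Gen_x i \<Rightarrow> 2 * i + 1) = (case h of Gen_y i \<Rightarrow> 2 * i | Gen_x i \<Rightarrow> 2 * i + 1)"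
    unfolding gen_prime_def
    using strict_mono_enumerate[OF primes_infinite] by (simp only: strict_mono_eq)
  then show "g = h"
    by (auto split: generator.splits; presburger)
qed

lemma wt_Nil [simp]: "wt [] = 1"
  and wt_append [simp]: "wt (u @ v) = wt u * wt v"
  and wt_Cons: "wt (g # v) = gen_prime g * wt v"
  by (simp_all add: wt_def)

lemma wt_pos [simp]: "wt u > 0"
  by (induction u) (auto simp: wt_Cons prime_gt_0_nat[OF prime_gen_prime])

lemma wt_mset: "wt u = prod_mset (image_mset gen_prime (mset u))"
  by (induction u) (auto simp: wt_Cons)

text \<open>Unique factorization: the weight is a product with one prime for each letter, and
  distinct generators have distinct primes, so the multiset of letters can be recovered.\<close>

lemma wt_eq_iff: "wt u = wt v \<longleftrightarrow> mset u = mset v"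
proof
  assume "wt u = wt v"
  then have "prime_factorization (\<Prod>\<^sub># (image_mset gen_prime (mset u))) = prime_factorization (\<Prod>\<^sub># (image_mset gen_prime (mset v)))"
    by (simp add: wt_mset)
  then have "image_mset gen_prime (mset u) = image_mset gen_prime (mset v)"
    by (subst (asm) (1 2) prime_factorization_prod_mset_primes) (auto simp: prime_gen_prime)
  then show "mset u = mset v"
    using inj_gen_prime by (metis inj_image_eq_iff multiset.inj_map injD)
qed (simp add: wt_mset)

section \<open>The exchange relations and the group generated by the parameters\<close>

locale quantum_weyl =
  fixes n r :: nat and \<Lambda> :: "nat \<Rightarrow> nat \<Rightarrow> 'k::field_char_0"
  assumes r_le: "r \<le> n" and antisym: "mult_antisymmetric n \<Lambda>"
begin

abbreviation "G \<equiv> S_gens n r"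
abbreviation "I \<equiv> S_ideal n r \<Lambda>"

definition L :: "'k set" where
  "L = generate (units_of (univ_ring :: 'k ring)) {\<Lambda> i j | i j. i \<in> {1..n} \<and> j \<in> {1..n}}"

lemma lam_nz: "i \<in> {1..n} \<Longrightarrow> j \<in> {1..n} \<Longrightarrow> \<Lambda> i j \<noteq> 0"
  and lam_inv: "i \<in> {1..n} \<Longrightarrow> j \<in> {1..n} \<Longrightarrow> inverse (\<Lambda> i j) = \<Lambda> j i"
  and lam_mult: "i \<in> {1..n} \<Longrightarrow> j \<in> {1..n} \<Longrightarrow> \<Lambda> i j * \<Lambda> j i = 1"
  and lam_refl: "i \<in> {1..n} \<Longrightarrow> \<Lambda> i i = 1"
  using antisym
  by (auto simp: mult_antisymmetric_def intro: inverse_unique)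

lemma subgroup_L: "subgroup L (units_of univ_ring)"
proof -
  interpret comm_group "units_of (univ_ring :: 'k ring)" by (rule comm_group_units_univ_ring)
  show ?thesis unfolding L_def
    by (rule generate_is_subgroup) (auto simp: carrier_units_univ_ring lam_nz)
qed

lemma L_nz: "a \<in> L \<Longrightarrow> a \<noteq> 0"
  using subgroup.subset[OF subgroup_L] by (auto simp: carrier_units_univ_ring)

lemma L_one: "1 \<in> L"
  using subgroup.one_closed[OF subgroup_L] by (simp add: one_units_univ_ring)

lemma L_mult: "a \<in> L \<Longrightarrow> b \<in> L \<Longrightarrow> a * b \<in> L"
  using subgroup.m_closed[OF subgroup_L] by (simp add: mult_units_univ_ring)

lemma L_inverse: "a \<in> L \<Longrightarrow> inverse a \<in> L"
  using subgroup.m_inv_closed[OF subgroup_L, of a] by (simp add: inv_units_univ_ring L_nz)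

lemma L_lam: "i \<in> {1..n} \<Longrightarrow> j \<in> {1..n} \<Longrightarrow> \<Lambda> i j \<in> L"
  unfolding L_def by (intro generate.incl) auto

lemma gens_cases:
  assumes "g \<in> G"
  obtains i where "g = Gen_y i" "i \<in> {1..n}" | i where "g = Gen_x i" "i \<in> {1..r}" "i \<in> {1..n}"
  using assms r_le by (auto simp: S_gens_def)

lemma I_carrier: "p \<in> I \<Longrightarrow> Poly_Mapping.keys p \<subseteq> lists G"
  using ideal.Icarr[OF ideal_S_ideal[OF r_le]] by (fastforce simp: free_algebra_def)

lemma I_add: "p \<in> I \<Longrightarrow> q \<in> I \<Longrightarrow> p + q \<in> I"
  using additive_subgroup.a_closed[OF ideal.axioms(1)[OF ideal_S_ideal[OF r_le]]]
  by (fastforce simp: free_algebra_def)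

lemma I_mult_left: "p \<in> I \<Longrightarrow> Poly_Mapping.keys q \<subseteq> lists G \<Longrightarrow> q * p \<in> I"
  using ideal.I_l_closed[OF ideal_S_ideal[OF r_le], where a = p and x = q]
  by (fastforce simp: free_algebra_def)

lemma I_mult_right: "p \<in> I \<Longrightarrow> Poly_Mapping.keys q \<subseteq> lists G \<Longrightarrow> p * q \<in> I"
  using ideal.I_r_closed[OF ideal_S_ideal[OF r_le], where a = p and x = q]
  by (fastforce simp: free_algebra_def)

lemma I_zero: "0 \<in> I"
  using additive_subgroup.zero_closed[OF ideal.axioms(1)[OF ideal_S_ideal[OF r_le]]]
  by (simp add: free_algebra_def)

lemma I_uminus: "p \<in> I \<Longrightarrow> - p \<in> I"
  using I_mult_left[of p "- 1"] by (simp add: zero_list_def)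

lemma relators_I: "p \<in> S_relators n r \<Lambda> \<Longrightarrow> p \<in> I"
  unfolding S_ideal_def
  using ring.genideal_self[OF ring_free_algebra S_relators_subset[OF r_le]] by blast

text \<open>All that the rewriting of words needs from the four families of relations, in a form
  that is uniform in the two letters and their order. The constant \<open>e\<close> is nonzero only
  for the letters \<open>x_i\<close> and \<open>y_i\<close> with the same index.\<close>

lemma swap_gens:
  assumes "g \<in> G" "h \<in> G"
  obtains l e where "l \<in> L"
    "Poly_Mapping.single [g, h] 1 - Poly_Mapping.single [h, g] l - Poly_Mapping.single [] e \<in> I"
    "r = 0 \<Longrightarrow> e = 0"
proof -
  have gg: "gen g * gen h = Poly_Mapping.single [g, h] 1" for g h :: generator
    by (simp add: gen_def mult_single plus_list_def)
  have sg: "scalar l * gen g * gen h = Poly_Mapping.single [g, h] l" for g h :: generator and l :: 'k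
    by (simp add: gen_def scalar_def mult_single plus_list_def)
  have one: "(1 :: generator list \<Rightarrow>\<^sub>0 'k) = Poly_Mapping.single [] 1"
    by (simp add: zero_list_def[symmetric])
  show thesis
    using assms(1)
  proof (cases rule: gens_cases)
    case gy: (1 i)
    show thesis
      using assms(2)
    proof (cases rule: gens_cases)
      case hy: (1 j)
      have "y_gen i * y_gen j - scalar (\<Lambda> i j) * y_gen j * y_gen i \<in> I"
        using gy(2) hy(2) by (intro relators_I) (unfold S_relators_def, blast)
      then show thesis
        using gy hy by (intro that[of "\<Lambda> i j" 0]) (auto simp: L_lam gg sg)
    next
      case hx: (2 j)
      show thesis
      proof (cases "i = j")
        case True
        have "x_gen i * y_gen i - (y_gen i * x_gen i + 1) \<in> I"
          using hx(2) True by (intro relators_I) (unfold S_relators_def, blast)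
        then have "- (x_gen i * y_gen i - (y_gen i * x_gen i + 1)) \<in> I"
          by (rule I_uminus)
        moreover have "- (x_gen i * y_gen i - (y_gen i * x_gen i + 1))
            = Poly_Mapping.single [g, h] 1 - Poly_Mapping.single [h, g] 1 - Poly_Mapping.single [] (- 1 :: 'k)"
          unfolding gg one gy hx True by (simp add: single_uminus)
        ultimately show thesis
          using hx by (intro that[of 1 "- 1"]) (auto simp: L_one)
      next
        case False
        have "x_gen j * y_gen i - scalar (inverse (\<Lambda> j i)) * y_gen i * x_gen j \<in> I"
          using gy(2) hx(2) False by (intro relators_I) (unfold S_relators_def, blast)
        \<comment> \<open>The relation has \<open>x\<close> in front of \<open>y\<close>;
          multiplying by this scalar solves it for the opposite order.\<close>
        then have "scalar (- \<Lambda> j i) * (x_gen j * y_gen i - scalar (inverse (\<Lambda> j i)) * y_gen i * x_gen j) \<in> I"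
          by (rule I_mult_left) (simp add: scalar_def)
        moreover have "scalar (- \<Lambda> j i) * (x_gen j * y_gen i - scalar (inverse (\<Lambda> j i)) * y_gen i * x_gen j)
            = Poly_Mapping.single [g, h] 1 - Poly_Mapping.single [h, g] (\<Lambda> j i) - Poly_Mapping.single [] 0"
          unfolding gg sg unfolding scalar_def gy hx
          using lam_nz[of j i] gy hx
          by (simp add: right_diff_distrib mult_single plus_list_def single_uminus)
        ultimately show thesis
          using gy hx by (intro that[of "\<Lambda> j i" 0]) (auto simp: L_lam)
      qed
    qed
  next
    case gx: (2 i)
    show thesis
      using assms(2)
    proof (cases rule: gens_cases)
      case hy: (1 j)
      show thesis
      proof (cases "i = j")
        case True
        have "x_gen i * y_gen i - (y_gen i * x_gen i + 1) \<in> I"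
          using gx(2) by (intro relators_I) (unfold S_relators_def, blast)
        then show thesis
          using gx hy True unfolding gg one
          by (intro that[of 1 1]) (auto simp: L_one diff_diff_eq)
      next
        case False
        have "x_gen i * y_gen j - scalar (inverse (\<Lambda> i j)) * y_gen j * x_gen i \<in> I"
          using gx(2) hy(2) False by (intro relators_I) (unfold S_relators_def, blast)
        then show thesis
          using gx hy by (intro that[of "inverse (\<Lambda> i j)" 0]) (auto simp: L_inverse L_lam gg sg)
      qed
    next
      case hx: (2 j)
      have "x_gen i * x_gen j - scalar (\<Lambda> i j) * x_gen j * x_gen i \<in> I"
        using gx(2) hx(2) by (intro relators_I) (unfold S_relators_def, blast)
      then show thesis
        using gx hx by (intro that[of "\<Lambda> i j" 0]) (auto simp: L_lam gg sg)
    qed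
  qed
qed

end

section \<open>Linear independence of the ordered monomials\<close>

context quantum_weyl
begin

text \<open>
  \<open>f\<close> is the coefficient function of the Laurent series \<open>\<Sum>f(t) y\<^sup>t\<close> in ordered monomials, on
  which \<open>y\<^sub>i\<close> acts by multiplication and \<open>x\<^sub>i\<close> as a twisted partial derivative.
\<close>

primrec act_gen :: "generator \<Rightarrow> ((nat \<Rightarrow> int) \<Rightarrow> 'k) \<Rightarrow> (nat \<Rightarrow> int) \<Rightarrow> 'k" where
  "act_gen (Gen_y i) f t = (\<Prod>j\<in>{1..<i}. \<Lambda> i j powi t j) * f (t(i := t i - 1))"
| "act_gen (Gen_x i) f t = of_int (t i + 1) * (\<Prod>j\<in>{1..<i}. \<Lambda> j i powi t j) * f (t(i := t i + 1))"

definition act :: "generator list \<Rightarrow> ((nat \<Rightarrow> int) \<Rightarrow> 'k) \<Rightarrow> (nat \<Rightarrow> int) \<Rightarrow> 'k" where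
  "act u = foldr act_gen u"

lemma act_Nil [simp]: "act [] f = f"
  and act_Cons: "act (g # u) f = act_gen g (act u f)"
  and act_append: "act (u @ v) f = act u (act v f)"
  by (simp_all add: act_def)

lemma act_gen_linear: "act_gen g (\<lambda>s. a * f s + b * h s) t = a * act_gen g f t + b * act_gen g h t"
  by (cases g) (simp_all add: algebra_simps)

lemma act_linear: "act u (\<lambda>s. a * f s + b * h s) t = a * act u f t + b * act u h t"
proof (induction u arbitrary: t)
  case (Cons g u)
  have "act u (\<lambda>s. a * f s + b * h s) = (\<lambda>s. a * act u f s + b * act u h s)"
    using Cons by blast
  then show ?case
    by (simp add: act_Cons act_gen_linear)
qed simp

definition act_poly :: "(generator list \<Rightarrow>\<^sub>0 'k) \<Rightarrow> ((nat \<Rightarrow> int) \<Rightarrow> 'k) \<Rightarrow> (nat \<Rightarrow> int) \<Rightarrow> 'k" where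
  "act_poly p f t = (\<Sum>u\<in>Poly_Mapping.keys p. Poly_Mapping.lookup p u * act u f t)"

lemma act_poly_superset:
  assumes "finite W" "Poly_Mapping.keys p \<subseteq> W"
  shows "act_poly p f t = (\<Sum>u\<in>W. Poly_Mapping.lookup p u * act u f t)"
  unfolding act_poly_def by (rule sum.mono_neutral_left) (use assms in \<open>auto simp: in_keys_iff\<close>)

lemma act_poly_zero [simp]: "act_poly 0 f t = 0"
  by (simp add: act_poly_def)

lemma act_poly_single [simp]: "act_poly (Poly_Mapping.single u c) f t = c * act u f t"
  by (subst act_poly_superset[of "{u}"]) auto

lemma act_poly_add: "act_poly (p + q) f t = act_poly p f t + act_poly q f t"
proof -
  let ?W = "Poly_Mapping.keys p \<union> Poly_Mapping.keys q"
  show ?thesis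
    using Poly_Mapping.keys_add[of p q]
    by (simp add: act_poly_superset[of ?W] lookup_add distrib_right sum.distrib)
qed

lemma act_poly_linear: "act_poly p (\<lambda>s. a * f s + b * h s) t = a * act_poly p f t + b * act_poly p h t"
  by (simp add: act_poly_def act_linear sum.distrib sum_distrib_left algebra_simps)

lemma act_poly_mult: "act_poly (p * q) f t = act_poly p (act_poly q f) t"
proof (induction p arbitrary: t rule: poly_mapping_monomial_induct)
  case (single u c)
  show ?case
  proof (induction q arbitrary: t rule: poly_mapping_monomial_induct)
    case zero
    then show ?case
      using act_linear[of u 0 f 0 f] by simp
  next
    case (single v d)
    then show ?case
      using act_linear[of u d "act v f" 0 f] by (simp add: mult_single plus_list_def act_append)
  next
    case (add q1 q2)
    have "act_poly (q1 + q2) f = (\<lambda>s. 1 * act_poly q1 f s + 1 * act_poly q2 f s)"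
      by (simp add: act_poly_add fun_eq_iff)
    then have "act_poly (Poly_Mapping.single u c) (act_poly (q1 + q2) f) t
        = 1 * act_poly (Poly_Mapping.single u c) (act_poly q1 f) t + 1 * act_poly (Poly_Mapping.single u c) (act_poly q2 f) t"
      by (simp only: act_poly_linear)
    moreover have "act_poly (Poly_Mapping.single u c * (q1 + q2)) f t
        = act_poly (Poly_Mapping.single u c) (act_poly q1 f) t + act_poly (Poly_Mapping.single u c) (act_poly q2 f) t"
      by (simp only: distrib_left act_poly_add add.IH)
    ultimately show ?case
      by (simp only: mult_1)
  qed
qed (simp_all add: act_poly_add distrib_right)

lemma act_poly_diff: "act_poly (p - q) f t = act_poly p f t - act_poly q f t"
  using act_poly_add[of "p - q" q f t] by simp

lemma act_poly_gen: "act_poly (gen g) f = act_gen g f"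
  by (simp add: gen_def act_Cons fun_eq_iff)

lemma act_poly_scalar: "act_poly (scalar c) f t = c * f t"
  by (simp add: scalar_def)

lemma act_poly_one: "act_poly 1 f t = f t"
  by (simp add: zero_list_def act_poly_superset[of "{[]}"] flip: scalar_one) (simp add: act_poly_scalar)

section \<open>The defining relations hold for the action\<close>

lemma prod_powi_incr:
  assumes "finite J" "m \<in> J \<Longrightarrow> c m \<noteq> 0"
  shows "(\<Prod>j\<in>J. c j powi (t(m := t m + (a :: int))) j) = (if m \<in> J then c m powi a else 1) * (\<Prod>j\<in>J. c j powi t j :: 'k)"
proof (cases "m \<in> J")
  case True
  then show ?thesis
    using assms by (simp add: prod.remove[where x = m] power_int_add mult.commute mult.left_commute)
next
  case False
  then show ?thesis
    by (auto intro!: prod.cong)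
qed

lemma prod_lam_y_incr:
  assumes "i \<in> {1..n}" "m \<in> {1..n}"
  shows "(\<Prod>j\<in>{1..<i}. \<Lambda> i j powi (t(m := t m + a)) j) = (if m < i then \<Lambda> i m powi a else 1) * (\<Prod>j\<in>{1..<i}. \<Lambda> i j powi t j)"
  using assms by (subst prod_powi_incr) (auto simp: lam_nz)

lemma prod_lam_x_incr:
  assumes "i \<in> {1..n}" "m \<in> {1..n}"
  shows "(\<Prod>j\<in>{1..<i}. \<Lambda> j i powi (t(m := t m + a)) j) = (if m < i then \<Lambda> m i powi a else 1) * (\<Prod>j\<in>{1..<i}. \<Lambda> j i powi t j)"
  using assms by (subst prod_powi_incr) (auto simp: lam_nz)

lemma prod_lam_inverse:
  assumes "i \<in> {1..n}"
  shows "(\<Prod>j\<in>{1..<i}. \<Lambda> i j powi t j) * (\<Prod>j\<in>{1..<i}. \<Lambda> j i powi t j) = 1"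
  using assms by (auto simp: lam_mult simp flip: prod.distrib power_int_mult_distrib intro!: prod.neutral)

text \<open>For different indices only the twist of the larger index sees a shift of the smaller
  exponent, so exactly one of the two compositions picks up a parameter. The same mechanism gives
  \<open>act_xx\<close> and \<open>act_xy\<close>.\<close>

lemma act_yy:
  assumes "i \<in> {1..n}" "j \<in> {1..n}"
  shows "act_gen (Gen_y i) (act_gen (Gen_y j) f) t = \<Lambda> i j * act_gen (Gen_y j) (act_gen (Gen_y i) f) t"
  using assms prod_lam_y_incr[of j i t "-1"] prod_lam_y_incr[of i j t "-1"] 
  by (cases i j rule: linorder_cases)
     (auto simp: lam_refl lam_inv lam_mult fun_upd_twist power_int_minus simp flip: mult.assoc)

lemma act_xx:
  assumes "i \<in> {1..n}" "j \<in> {1..n}"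
  shows "act_gen (Gen_x i) (act_gen (Gen_x j) f) t = \<Lambda> i j * act_gen (Gen_x j) (act_gen (Gen_x i) f) t"
  using assms prod_lam_x_incr[of j i t 1] prod_lam_x_incr[of i j t 1] 
  by (cases i j rule: linorder_cases)
     (auto simp: lam_refl lam_inv lam_mult fun_upd_twist)

lemma act_xy:
  assumes "i \<in> {1..n}" "j \<in> {1..n}" "i \<noteq> j"
  shows "act_gen (Gen_x i) (act_gen (Gen_y j) f) t = inverse (\<Lambda> i j) * act_gen (Gen_y j) (act_gen (Gen_x i) f) t"
  using assms prod_lam_y_incr[of j i t 1] prod_lam_x_incr[of i j t "-1"] 
  by (cases i j rule: linorder_cases)
     (auto simp: lam_refl lam_inv lam_mult fun_upd_twist power_int_minus)

text \<open>The twists of \<open>x_i\<close> and \<open>y_i\<close> are inverse to each other by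
  \<open>prod_lam_inverse\<close>; what remains is the Weyl relation
  \<open>(t i + 1) - t i = 1\<close> between derivative and multiplication.\<close>

lemma act_xy_same:
  assumes "i \<in> {1..n}"
  shows "act_gen (Gen_x i) (act_gen (Gen_y i) f) t = act_gen (Gen_y i) (act_gen (Gen_x i) f) t + f t"
  using assms prod_lam_y_incr[of i i t 1] prod_lam_x_incr[of i i t "-1"] prod_lam_inverse[of i t]
  by (simp add: algebra_simps)

text \<open>The elements acting as zero form a two-sided ideal that contains the relators, hence the
  ideal generated by them. The action thus descends to \<open>S\<close> and can detect that an
  element is nonzero there.\<close>

lemma act_poly_I:
  assumes "p \<in> I"
  shows "act_poly p f t = 0"
proof -
  let ?A = "free_algebra G :: (generator list \<Rightarrow>\<^sub>0 'k) ring"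
  let ?J = "{p \<in> carrier ?A. \<forall>f t. act_poly p f t = 0}"
  interpret ring ?A by (rule ring_free_algebra)
  have "ideal ?J ?A"
  proof (rule idealI[OF ring_axioms])
    show "subgroup ?J (add_monoid ?A)"
    proof (rule group.subgroupI)
      show "group (add_monoid ?A)" by (rule a_group)
      fix p assume p: "p \<in> ?J"
      have "inv\<^bsub>add_monoid ?A\<^esub> p = - p"
        using p unfolding a_inv_def[symmetric]
        by (intro minus_equality[symmetric] minus_equality) (auto simp: free_algebra_def)
      then show "inv\<^bsub>add_monoid ?A\<^esub> p \<in> ?J"
        using p act_poly_diff[of 0 p] by (auto simp: free_algebra_def)
    qed (auto simp: free_algebra_def act_poly_add dest: free_algebra_add_closed[THEN subsetD, rotated 2]
        intro: exI[of _ 0])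
  next
    fix p q assume "p \<in> ?J" "q \<in> carrier ?A"
    moreover have "act_poly q (\<lambda>_. 0) t = 0" for t
      using act_poly_linear[of q 0 "\<lambda>_. 0" 0 "\<lambda>_. 0" t] by simp
    moreover have "act_poly p f = (\<lambda>_. 0)" for f
      using \<open>p \<in> ?J\<close> by auto
    ultimately show "q \<otimes>\<^bsub>?A\<^esub> p \<in> ?J" "p \<otimes>\<^bsub>?A\<^esub> q \<in> ?J"
      using free_algebra_mult_closed[of q G p] free_algebra_mult_closed[of p G q]
      by (simp_all add: free_algebra_def act_poly_mult)
  qed
  moreover have "S_relators n r \<Lambda> \<subseteq> ?J"
  proof
    fix p assume p: "p \<in> S_relators n r \<Lambda>"
    note eval = act_poly_diff act_poly_add act_poly_mult act_poly_one act_poly_scalar mult.assoc act_poly_gen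
    have *: "i \<in> {1..n}" if "i \<in> {1..r}" for i
      using that r_le by simp
    consider (yy) i j where "i \<in> {1..n}" "j \<in> {1..n}"
        "p = y_gen i * y_gen j - scalar (\<Lambda> i j) * y_gen j * y_gen i"
      | (xy_same) i where "i \<in> {1..n}" "p = x_gen i * y_gen i - (y_gen i * x_gen i + 1)"
      | (xy) i j where "i \<in> {1..n}" "j \<in> {1..n}" "i \<noteq> j"
        "p = x_gen i * y_gen j - scalar (inverse (\<Lambda> i j)) * y_gen j * x_gen i"
      | (xx) i j where "i \<in> {1..n}" "j \<in> {1..n}"
        "p = x_gen i * x_gen j - scalar (\<Lambda> i j) * x_gen j * x_gen i"
      using p * unfolding S_relators_def by blast
    then have "act_poly p f t = 0" for f t
    proof cases
      case (yy i j)
      then show ?thesis using act_yy[of i j f t] by (simp add: eval del: act_gen.simps)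
    next
      case (xy_same i)
      then show ?thesis using act_xy_same[of i f t] by (simp add: eval del: act_gen.simps)
    next
      case (xy i j)
      then show ?thesis using act_xy[of i j f t] by (simp add: eval del: act_gen.simps)
    next
      case (xx i j)
      then show ?thesis using act_xx[of i j f t] by (simp add: eval del: act_gen.simps)
    qed
    then show "p \<in> ?J"
      using p S_relators_subset[OF r_le] by blast
  qed
  ultimately show ?thesis
    using genideal_minimal assms unfolding S_ideal_def by blast
qed

text \<open>Only vanishing is tracked: the twists are products of powers of nonzero parameters, so a
  word in the \<open>y\<close>s shifts the exponents up to a nonzero factor.\<close>

lemma act_y_nonzero:
  assumes "set ks \<subseteq> {1..n}"
  shows "act (map Gen_y ks) f t \<noteq> 0 \<longleftrightarrow> f (\<lambda>i. t i - int (count (mset ks) i)) \<noteq> 0"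
  using assms
proof (induction ks arbitrary: t)
  case (Cons k ks)
  have "(\<Prod>j\<in>{1..<k}. \<Lambda> k j powi t j) \<noteq> 0"
    using Cons.prems by (auto simp: lam_nz)
  moreover have "(\<lambda>i. (t(k := t k - 1)) i - int (count (mset ks) i)) = (\<lambda>i. t i - int (count (mset (k # ks)) i))"
    by auto
  ultimately show ?case
    using Cons by (simp add: act_Cons)
qed simp

text \<open>The factor \<open>t k + 1\<close> vanishes in characteristic 0 exactly at
  \<open>t k = -1\<close>. This is what keeps the support within nonnegative exponents, and it loses
  nothing else.\<close>

lemma act_x_nonzero:
  assumes "set js \<subseteq> {1..n}" "\<And>s. f s \<noteq> 0 \<Longrightarrow> (\<forall>i. 0 \<le> s i)"
  shows "act (map Gen_x js) f t \<noteq> 0 \<longleftrightarrow> (\<forall>i. 0 \<le> t i) \<and> f (\<lambda>i. t i + int (count (mset js) i)) \<noteq> 0"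
  using assms(1)
proof (induction js arbitrary: t)
  case Nil
  then show ?case using assms(2) by auto
next
  case (Cons k js)
  have "(\<Prod>j\<in>{1..<k}. \<Lambda> j k powi t j) \<noteq> 0"
    using Cons.prems by (auto simp: lam_nz)
  moreover have "(\<lambda>i. (t(k := t k + 1)) i + int (count (mset js) i)) = (\<lambda>i. t i + int (count (mset (k # js)) i))"
    by auto
  moreover have "of_int (t k + 1) = (0 :: 'k) \<longleftrightarrow> t k + 1 = 0"
    by (rule of_int_eq_0_iff)
  moreover have "t k + 1 \<noteq> 0 \<and> (\<forall>i. 0 \<le> (t(k := t k + 1)) i) \<longleftrightarrow> (\<forall>i. 0 \<le> t i)"
  proof safe
    fix i assume "t k + 1 \<noteq> 0" "\<forall>i. 0 \<le> (t(k := t k + 1)) i"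
    then show "0 \<le> t i"
      by (cases "i = k") (auto dest: spec[of _ i])
  qed (auto dest: spec[of _ k])
  ultimately show ?case
    using Cons by (simp only: act_Cons act_gen.simps list.map mult_eq_0_iff) auto
qed

text \<open>Only the blocks are ordered, not the letters within a block; independence is therefore
  claimed for sets with at most one word for each multiset. Twisted derivations are available for
  all indices up to \<open>n\<close>, which explains the bound for the \<open>x\<close>s.\<close>

definition normal_words :: "generator list set" where
  "normal_words = {map Gen_y ks @ map Gen_x js | ks js. set ks \<subseteq> {1..n} \<and> set js \<subseteq> {1..n}}"

lemma act_normal_nonzero:
  assumes "u \<in> normal_words" "\<And>s. f s \<noteq> 0 \<Longrightarrow> (\<forall>i. 0 \<le> s i)"
  shows "act u f t \<noteq> 0 \<longleftrightarrow> (\<forall>i. int (count (mset u) (Gen_y i)) \<le> t i)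
    \<and> f (\<lambda>i. t i - int (count (mset u) (Gen_y i)) + int (count (mset u) (Gen_x i))) \<noteq> 0"
proof -
  obtain ks js where u: "u = map Gen_y ks @ map Gen_x js" "set ks \<subseteq> {1..n}" "set js \<subseteq> {1..n}"
    using assms(1) by (auto simp: normal_words_def)
  have y: "count (mset (map Gen_y ks)) (Gen_y i) = count (mset ks) i" "count (mset (map Gen_y ks)) (Gen_x i) = 0" for ks i
    by (induction ks) auto
  have x: "count (mset (map Gen_x ks)) (Gen_x i) = count (mset ks) i" "count (mset (map Gen_x ks)) (Gen_y i) = 0" for ks i
    by (induction ks) auto
  have "count (mset u) (Gen_y i) = count (mset ks) i" "count (mset u) (Gen_x i) = count (mset js) i" for i
    unfolding u(1) mset_append count_union x y by simp_all
  then show ?thesis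
    using act_y_nonzero[OF u(2)] act_x_nonzero[OF u(3) assms(2)]
    by (simp add: u(1) act_append)
qed

text \<open>
  A word with a minimal number of \<open>x\<close>s is isolated by acting on the indicator function of its
  \<open>x\<close>-exponent vector.
\<close>

lemma normal_words_independent:
  assumes "p \<in> I" "Poly_Mapping.keys p \<subseteq> normal_words" "inj_on mset (Poly_Mapping.keys p)"
  shows "p = 0"
proof (rule ccontr)
  assume "p \<noteq> 0"
  then obtain w where "w \<in> Poly_Mapping.keys p"
    by (metis all_not_in_conv keys_eq_empty)
  define xs where "xs u = filter_mset (\<lambda>g. \<exists>i. g = Gen_x i) (mset u)" for u
  obtain u where u: "u \<in> Poly_Mapping.keys p" "\<And>v. v \<in> Poly_Mapping.keys p \<Longrightarrow> size (xs u) \<le> size (xs v)"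
    using ex_has_least_nat[of "\<lambda>u. u \<in> Poly_Mapping.keys p" w "\<lambda>u. size (xs u)"] \<open>w \<in> _\<close> by blast
  define f :: "(nat \<Rightarrow> int) \<Rightarrow> 'k" where "f s = (if s = (\<lambda>i. int (count (mset u) (Gen_x i))) then 1 else 0)" for s
  define t where "t i = int (count (mset u) (Gen_y i))" for i
  have act_iff: "act v f t \<noteq> 0 \<longleftrightarrow> (\<forall>i. count (mset v) (Gen_y i) \<le> count (mset u) (Gen_y i)) \<and>
      (\<forall>i. int (count (mset u) (Gen_y i)) - int (count (mset v) (Gen_y i)) + int (count (mset v) (Gen_x i)) = int (count (mset u) (Gen_x i)))"
    if "v \<in> Poly_Mapping.keys p" for v
  proof -
    have "v \<in> normal_words" "\<And>s. f s \<noteq> 0 \<Longrightarrow> \<forall>i. 0 \<le> s i"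
      using that assms(2) by (auto simp: f_def split: if_splits)
    from act_normal_nonzero[OF this(1), where f = f and t = t, OF this(2)] show ?thesis
      by (auto simp: f_def t_def fun_eq_iff split: if_splits)
  qed
  have "v = u" if v: "v \<in> Poly_Mapping.keys p" "act v f t \<noteq> 0" for v
  proof -
    note * = act_iff[OF v(1), THEN iffD1, OF v(2)]
    \<comment> \<open>If \<open>v\<close> does not vanish at \<open>t\<close>, its
      \<open>y\<close>-exponents are at most those of \<open>u\<close> and the differences of
      \<open>x\<close>- and \<open>y\<close>-exponents agree, so its \<open>x\<close>-exponents are
      bounded as well. Minimality of \<open>u\<close> then forces equality.\<close>
    have x: "count (mset v) (Gen_x i) \<le> count (mset u) (Gen_x i)" for i
      using conjunct1[OF *, rule_format, of i] conjunct2[OF *, rule_format, of i] by linarith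
    have "xs v \<subseteq># xs u"
      unfolding subseteq_mset_def xs_def using x by auto
    then have "xs v = xs u"
      using u(2)[OF v(1)] by (metis mset_subset_size not_le subset_mset.le_neq_trans)
    then have xeq: "count (mset v) (Gen_x i) = count (mset u) (Gen_x i)" for i
      unfolding xs_def by (metis (mono_tags, lifting) count_filter_mset)
    have "mset v = mset u"
    proof (rule multiset_eqI)
      fix g show "count (mset v) g = count (mset u) g"
        using xeq conjunct2[OF *] by (cases g) auto
    qed
    then show ?thesis
      using assms(3) u(1) v(1) by (auto dest: inj_onD)
  qed
  then have "act_poly p f t = (\<Sum>v\<in>{u}. Poly_Mapping.lookup p v * act v f t)"
    unfolding act_poly_def using u(1) by (intro sum.mono_neutral_right) auto
  moreover have "act u f t \<noteq> 0"
    using act_iff[OF u(1)] by simp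
  ultimately show False
    using act_poly_I[OF assms(1)] u(1) by (simp add: in_keys_iff)
qed

end

section \<open>Leading terms\<close>

text \<open>Negative keys for the \<open>y\<close>s and nonnegative ones for the \<open>x\<close>s
  make sorting put the \<open>y\<close>s first; the shift by 1 keeps the two letters of index 0
  apart.\<close>

primrec gen_key :: "generator \<Rightarrow> int" where
  "gen_key (Gen_y i) = - int i - 1"
| "gen_key (Gen_x i) = int i"

lemma inj_gen_key: "inj gen_key"
proof (rule injI)
  fix g h show "gen_key g = gen_key h \<Longrightarrow> g = h"
    by (cases g; cases h) auto
qed

lemma sorted_gen_key_normal:
  assumes "sorted (map gen_key u)"
  shows "\<exists>ks js. u = map Gen_y ks @ map Gen_x js"
  using assms
proof (induction u)
  case (Cons g u)
  then obtain ks js where u: "u = map Gen_y ks @ map Gen_x js"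
    by auto
  show ?case
  proof (cases g)
    case (Gen_y i)
    then show ?thesis
      using u by (intro exI[of _ "i # ks"] exI[of _ js]) simp
  next
    case (Gen_x i)
    then have "ks = []"
      using Cons.prems u by (cases ks) auto
    then show ?thesis
      using u Gen_x by (intro exI[of _ "[]"] exI[of _ "i # js"]) simp
  qed
qed simp

context quantum_weyl
begin

text \<open>The preimage in the free algebra of the linear span of \<open>W\<close> in
  \<open>S\<close>, so that \<open>S\<close> is handled through representatives.\<close>

definition spn :: "generator list set \<Rightarrow> (generator list \<Rightarrow>\<^sub>0 'k) set" where
  "spn W = {p. \<exists>q. Poly_Mapping.keys q \<subseteq> W \<and> p - q \<in> I}"

lemma spnI: "Poly_Mapping.keys q \<subseteq> W \<Longrightarrow> p - q \<in> I \<Longrightarrow> p \<in> spn W"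
  by (auto simp: spn_def)

lemma spn_keys: "Poly_Mapping.keys q \<subseteq> W \<Longrightarrow> q \<in> spn W"
  by (rule spnI) (auto simp: I_zero)

lemma I_subset_spn: "p \<in> I \<Longrightarrow> p \<in> spn W"
  by (rule spnI[of 0]) auto

lemma spn_mono: "p \<in> spn V \<Longrightarrow> V \<subseteq> W \<Longrightarrow> p \<in> spn W"
  by (auto simp: spn_def)

lemma spn_add:
  assumes "p \<in> spn W" "q \<in> spn W"
  shows "p + q \<in> spn W"
proof -
  obtain a b where "Poly_Mapping.keys a \<subseteq> W" "p - a \<in> I" "Poly_Mapping.keys b \<subseteq> W" "q - b \<in> I"
    using assms by (auto simp: spn_def)
  then show ?thesis
    using Poly_Mapping.keys_add[of a b] I_add[of "p - a" "q - b"]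
    by (intro spnI[of "a + b"]) (auto simp: algebra_simps)
qed

lemma spn_carrier:
  assumes "p \<in> spn W" "W \<subseteq> lists G"
  shows "Poly_Mapping.keys p \<subseteq> lists G"
proof -
  obtain q where "Poly_Mapping.keys q \<subseteq> W" "p - q \<in> I"
    using assms by (auto simp: spn_def)
  then show ?thesis
    using free_algebra_add_closed[of "p - q" G q] I_carrier[of "p - q"] assms(2) by simp
qed

lemma spn_mult:
  assumes p: "p \<in> spn V" and q: "q \<in> spn W" and "V \<subseteq> lists G" "W \<subseteq> lists G"
    and X: "\<And>u v. u \<in> V \<Longrightarrow> v \<in> W \<Longrightarrow> u @ v \<in> X"
  shows "p * q \<in> spn X"
proof -
  obtain a b where ab: "Poly_Mapping.keys a \<subseteq> V" "p - a \<in> I" "Poly_Mapping.keys b \<subseteq> W" "q - b \<in> I"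
    using p q by (auto simp: spn_def)
  have "p * q - a * b = (p - a) * q + a * (q - b)"
    by (simp add: algebra_simps)
  moreover have "(p - a) * q \<in> I"
    using ab spn_carrier[OF q] assms(4) by (intro I_mult_right)
  moreover have "a * (q - b) \<in> I"
    using ab assms(3) by (intro I_mult_left) auto
  ultimately have "p * q - a * b \<in> I"
    using I_add by simp
  moreover have "Poly_Mapping.keys (a * b) \<subseteq> X"
    using Poly_Mapping.keys_mult[of a b] ab X by (fastforce simp: plus_list_def)
  ultimately show ?thesis
    by (intro spnI)
qed

lemma spn_scale:
  assumes "p \<in> spn W" "W \<subseteq> lists G"
  shows "Poly_Mapping.single [] c * p \<in> spn W"
proof (rule spn_mult[OF _ assms(1) _ assms(2)])
  show "Poly_Mapping.single [] c \<in> spn {[]}"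
    by (rule spn_keys) simp
qed auto

lemma spn_uminus: "p \<in> spn W \<Longrightarrow> W \<subseteq> lists G \<Longrightarrow> - p \<in> spn W"
  using spn_scale[of p W "- 1"] by (simp add: single_uminus flip: zero_list_def)

lemma spn_diff: "p \<in> spn W \<Longrightarrow> q \<in> spn W \<Longrightarrow> W \<subseteq> lists G \<Longrightarrow> p - q \<in> spn W"
  using spn_add[OF _ spn_uminus] by fastforce

lemma spn_trans:
  assumes p: "p \<in> spn V" and "W \<subseteq> lists G"
    and "\<And>u. u \<in> V \<Longrightarrow> Poly_Mapping.single u 1 \<in> spn W"
  shows "p \<in> spn W"
proof -
  obtain q where q: "Poly_Mapping.keys q \<subseteq> V" "p - q \<in> I"
    using p by (auto simp: spn_def)
  have single: "Poly_Mapping.single u c \<in> spn W" if "u \<in> V" for u c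
    using spn_scale[OF assms(3)[OF that] assms(2), of c] by (simp add: mult_single plus_list_def)
  have "(\<Sum>u\<in>K. Poly_Mapping.single u (Poly_Mapping.lookup q u)) \<in> spn W" if "finite K" "K \<subseteq> V" for K
    using that by (induction K) (auto intro: spn_add single I_subset_spn I_zero)
  then have "q \<in> spn W"
    using q(1) by (subst poly_mapping_sum_single) simp
  then show ?thesis
    using spn_add[OF _ I_subset_spn[OF q(2)], of q W] by simp
qed

section \<open>The weight filtration and normal forms\<close>

definition below :: "nat \<Rightarrow> generator list set" where
  "below m = {u \<in> lists G. wt u < m}"

lemma below_lists: "below m \<subseteq> lists G"
  by (auto simp: below_def)

lemma below_mono: "m \<le> m' \<Longrightarrow> below m \<subseteq> below m'"
  by (auto simp: below_def)

text \<open>Every letter weighs at least 2, so the word left by the constant term of an exchange has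
  smaller weight.\<close>

lemma wt_swap_less: "wt (u @ v) < wt (u @ [g, h] @ v)"
proof -
  have "1 * 1 < gen_prime g * gen_prime h"
    using prime_gt_1_nat[OF prime_gen_prime] prime_gt_0_nat[OF prime_gen_prime] by (intro mult_strict_mono) auto
  then show ?thesis
    by (simp add: wt_Cons)
qed

text \<open>Each adjacent exchange contributes a factor in \<open>L\<close> and a multiple of a word
  with two letters fewer. For \<open>r = 0\<close> these corrections vanish and the rearrangement is
  exact modulo the ideal.\<close>

lemma rearrange:
  assumes "mset u = mset v" "u \<in> lists G"
  obtains l where "l \<in> L" "Poly_Mapping.single u 1 - Poly_Mapping.single v l \<in> spn (below (wt u))"
    "r = 0 \<Longrightarrow> Poly_Mapping.single u 1 - Poly_Mapping.single v l \<in> I"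
proof -
  define P where "P u v \<longleftrightarrow> wt u = wt v \<and> (\<exists>l\<in>L. Poly_Mapping.single u 1 - Poly_Mapping.single v l \<in> spn (below (wt u))
      \<and> (r = 0 \<longrightarrow> Poly_Mapping.single u 1 - Poly_Mapping.single v l \<in> I))" for u v
  have "P u v"
    using assms
  proof (rule mset_eq_swap_induct)
    fix w assume "w \<in> lists G"
    show "P w w"
      unfolding P_def using L_one I_zero I_subset_spn[OF I_zero] by (intro conjI bexI[of _ 1] impI) simp_all
  next
    fix u v w assume "P u v" "P v w"
    then obtain l l' where l: "l \<in> L" "Poly_Mapping.single u 1 - Poly_Mapping.single v l \<in> spn (below (wt u))"
        "r = 0 \<Longrightarrow> Poly_Mapping.single u 1 - Poly_Mapping.single v l \<in> I"
      and l': "l' \<in> L" "Poly_Mapping.single v 1 - Poly_Mapping.single w l' \<in> spn (below (wt u))"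
        "r = 0 \<Longrightarrow> Poly_Mapping.single v 1 - Poly_Mapping.single w l' \<in> I"
      and wt: "wt u = wt v" "wt v = wt w"
      by (auto simp: P_def)
    have eq: "Poly_Mapping.single u 1 - Poly_Mapping.single w (l * l')
        = (Poly_Mapping.single u 1 - Poly_Mapping.single v l)
          + Poly_Mapping.single [] l * (Poly_Mapping.single v 1 - Poly_Mapping.single w l')"
      by (simp add: right_diff_distrib mult_single plus_list_def)
    show "P u w"
      unfolding P_def
    proof (intro conjI bexI[of _ "l * l'"] impI)
      show "Poly_Mapping.single u 1 - Poly_Mapping.single w (l * l') \<in> spn (below (wt u))"
        unfolding eq using l l' by (intro spn_add spn_scale below_lists)
      show "Poly_Mapping.single u 1 - Poly_Mapping.single w (l * l') \<in> I" if "r = 0"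
        unfolding eq using l l' that by (intro I_add I_mult_left) auto
      show "wt u = wt w"
        using wt by simp
      show "l * l' \<in> L"
        using l(1) l'(1) by (rule L_mult)
    qed
  next
    fix u v g h assume uv: "u \<in> lists G" "v \<in> lists G" "g \<in> G" "h \<in> G"
    obtain l e where le: "l \<in> L" "r = 0 \<Longrightarrow> e = 0"
      "Poly_Mapping.single [g, h] 1 - Poly_Mapping.single [h, g] l - Poly_Mapping.single [] e \<in> I"
      using swap_gens[OF uv(3,4)] by metis
    have "Poly_Mapping.single u 1 * (Poly_Mapping.single [g, h] 1 - Poly_Mapping.single [h, g] l - Poly_Mapping.single [] e) * Poly_Mapping.single v 1 \<in> I"
      using le uv by (intro I_mult_left I_mult_right) auto
    then have *: "Poly_Mapping.single (u @ [g, h] @ v) 1 - Poly_Mapping.single (u @ [h, g] @ v) l - Poly_Mapping.single (u @ v) e \<in> I"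
      by (simp add: left_diff_distrib right_diff_distrib mult_single plus_list_def)
    have "Poly_Mapping.keys (Poly_Mapping.single (u @ v) e) \<subseteq> below (wt (u @ [g, h] @ v))"
      using uv wt_swap_less[of u v g h] by (auto simp: below_def)
    then have "Poly_Mapping.single (u @ [g, h] @ v) 1 - Poly_Mapping.single (u @ [h, g] @ v) l \<in> spn (below (wt (u @ [g, h] @ v)))"
      using * by (rule spnI)
    moreover have "Poly_Mapping.single (u @ [g, h] @ v) 1 - Poly_Mapping.single (u @ [h, g] @ v) l \<in> I" if "r = 0"
      using * le(2)[OF that] by (simp only: single_zero diff_zero)
    ultimately show "P (u @ [g, h] @ v) (u @ [h, g] @ v)"
      unfolding P_def using le(1) by (intro conjI bexI[of _ l] impI) (simp_all add: wt_Cons)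
  qed
  then show thesis
    using that by (auto simp: P_def)
qed

definition nf :: "generator list \<Rightarrow> generator list" where
  "nf = sort_key gen_key"

lemma mset_nf [simp]: "mset (nf u) = mset u"
  by (simp add: nf_def)

lemma nf_lists: "nf u \<in> lists G \<longleftrightarrow> u \<in> lists G"
  by (auto simp: nf_def)

lemma wt_nf [simp]: "wt (nf u) = wt u"
  by (simp add: wt_eq_iff)

lemma nf_eqI: "mset u = mset v \<Longrightarrow> nf u = nf v"
  unfolding nf_def
  by (rule sort_key_inj_key_eq) (auto intro: inj_on_subset[OF inj_gen_key])

lemma nf_nf [simp]: "nf (nf u) = nf u"
  by (rule nf_eqI) simp

lemma nf_normal:
  assumes "u \<in> lists G"
  shows "nf u \<in> normal_words"
proof -
  obtain ks js where nf: "nf u = map Gen_y ks @ map Gen_x js"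
    using sorted_gen_key_normal[of "nf u"] by (auto simp: nf_def)
  then have "set (map Gen_y ks @ map Gen_x js) \<subseteq> G"
    using assms nf_lists[of u] by auto
  then show ?thesis
    unfolding normal_words_def nf using r_le by (force simp: S_gens_def)
qed

text \<open>Strong induction on the weight: sorting a word produces errors of strictly smaller
  weight, which are already expressed by sorted words.\<close>

lemma below_normalize:
  assumes "p \<in> spn (below m)"
  shows "p \<in> spn {u \<in> below m. nf u = u}"
proof -
  have "Poly_Mapping.single u 1 \<in> spn {v \<in> below m. nf v = v}" if "u \<in> below m" for u m
    using that
  proof (induction "wt u" arbitrary: u m rule: less_induct)
    case less
    obtain l where l: "Poly_Mapping.single u 1 - Poly_Mapping.single (nf u) l \<in> spn (below (wt u))"
      using rearrange[of u "nf u"] less.prems below_lists by (metis mset_nf subsetD)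
    then have "Poly_Mapping.single u 1 - Poly_Mapping.single (nf u) l \<in> spn {v \<in> below m. nf v = v}"
    proof (rule spn_trans)
      fix v assume v: "v \<in> below (wt u)"
      then have "Poly_Mapping.single v 1 \<in> spn {w \<in> below (wt u). nf w = w}"
        by (intro less.hyps) (auto simp: below_def)
      then show "Poly_Mapping.single v 1 \<in> spn {w \<in> below m. nf w = w}"
        using less.prems by (elim spn_mono) (auto simp: below_def)
    qed (use below_lists in auto)
    moreover have "Poly_Mapping.single (nf u) l \<in> spn {v \<in> below m. nf v = v}"
      using less.prems nf_lists by (intro spn_keys) (auto simp: below_def)
    ultimately show ?case
      using spn_add by fastforce
  qed
  then show ?thesis
    by (intro spn_trans[OF assms]) (auto simp: below_def)
qed

text \<open>Here the linear independence enters. Once the word and the lower terms are sorted, the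
  hypothesis becomes a linear relation between normal words with distinct multisets, in which the
  coefficient of \<open>nf u\<close> is \<open>c * l\<close> with \<open>l\<close> nonzero.\<close>

lemma single_not_below:
  assumes u: "u \<in> lists G" and "Poly_Mapping.single u c \<in> spn (below (wt u))"
  shows "c = 0"
proof -
  obtain l where l: "l \<in> L" "Poly_Mapping.single u 1 - Poly_Mapping.single (nf u) l \<in> spn (below (wt u))"
    using rearrange[of u "nf u"] u by auto
  have "Poly_Mapping.single (nf u) (c * l)
      = Poly_Mapping.single u c - Poly_Mapping.single [] c * (Poly_Mapping.single u 1 - Poly_Mapping.single (nf u) l)"
    by (simp add: right_diff_distrib mult_single plus_list_def)
  also have "\<dots> \<in> spn {v \<in> below (wt u). nf v = v}"
    by (rule below_normalize[OF spn_diff[OF assms(2) spn_scale[OF l(2) below_lists] below_lists]])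
  finally obtain q where q: "Poly_Mapping.keys q \<subseteq> {v \<in> below (wt u). nf v = v}"
      "Poly_Mapping.single (nf u) (c * l) - q \<in> I"
    by (auto simp: spn_def)
  let ?p = "Poly_Mapping.single (nf u) (c * l) - q"
  have keys: "Poly_Mapping.keys ?p \<subseteq> insert (nf u) (Poly_Mapping.keys q)"
    by (auto simp: in_keys_iff lookup_minus lookup_single when_def split: if_splits)
  have "?p = 0"
  proof (rule normal_words_independent[OF q(2)])
    have "v \<in> normal_words" if "v \<in> insert (nf u) (Poly_Mapping.keys q)" for v
      using that q(1) nf_normal[of v] nf_normal[OF u] by (fastforce simp: below_def)
    then show "Poly_Mapping.keys ?p \<subseteq> normal_words"
      using keys by auto
    show "inj_on mset (Poly_Mapping.keys ?p)"
    proof (rule inj_onI)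
      have nf: "nf v = v" if "v \<in> Poly_Mapping.keys ?p" for v
        using subsetD[OF keys that] q(1) by auto
      fix v w assume "v \<in> Poly_Mapping.keys ?p" "w \<in> Poly_Mapping.keys ?p" "mset v = mset w"
      then show "v = w"
        using nf nf_eqI by metis
    qed
  qed
  then have "Poly_Mapping.lookup ?p (nf u) = 0"
    by simp
  moreover have "Poly_Mapping.lookup q (nf u) = 0"
    using q(1) by (auto simp: below_def in_keys_iff)
  ultimately show ?thesis
    using L_nz[OF l(1)] by (simp add: lookup_minus)
qed

text \<open>A relation and not a function, because \<open>p\<close> does not determine the pair:
  reordering the letters of \<open>u\<close> multiplies \<open>c\<close> by an element of
  \<open>L\<close>. As \<open>spn\<close> absorbs the ideal, it only depends on the class of
  \<open>p\<close> in \<open>S\<close>.\<close>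

definition lead :: "(generator list \<Rightarrow>\<^sub>0 'k) \<Rightarrow> 'k \<Rightarrow> generator list \<Rightarrow> bool" where
  "lead p c u \<longleftrightarrow> u \<in> lists G \<and> c \<noteq> 0 \<and> p - Poly_Mapping.single u c \<in> spn (below (wt u))"

text \<open>Among sorted words the weight is injective, so the maximal weight in a sorted
  representative is attained by a single word.\<close>

lemma lead_exists_below:
  assumes "p \<in> spn (below m)" "p \<notin> I"
  obtains c u where "lead p c u" "wt u < m"
proof -
  obtain q where q: "Poly_Mapping.keys q \<subseteq> {u \<in> below m. nf u = u}" "p - q \<in> I"
    using below_normalize[OF assms(1)] by (auto simp: spn_def)
  have "Poly_Mapping.keys q \<noteq> {}"
    using q(2) assms(2) by (auto simp: keys_eq_empty)
  then have "Max (wt ` Poly_Mapping.keys q) \<in> wt ` Poly_Mapping.keys q"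
    by (intro Max_in) auto
  then obtain u where u: "u \<in> Poly_Mapping.keys q" "wt u = Max (wt ` Poly_Mapping.keys q)"
    by auto
  let ?c = "Poly_Mapping.lookup q u"
  have "v \<in> below (wt u)" if v: "v \<in> Poly_Mapping.keys (q - Poly_Mapping.single u ?c)" for v
  proof -
    have vu: "v \<noteq> u" "v \<in> Poly_Mapping.keys q"
      using v by (auto simp: in_keys_iff lookup_minus lookup_single when_def split: if_splits)
    then have "wt v \<le> wt u"
      unfolding u(2) by simp
    moreover have "wt v \<noteq> wt u"
      using vu q(1) u(1) nf_eqI[of v u] unfolding wt_eq_iff by (metis (mono_tags, lifting) mem_Collect_eq subsetD)
    ultimately show ?thesis
      using vu q(1) by (auto simp: below_def)
  qed
  then have "p - Poly_Mapping.single u ?c \<in> spn (below (wt u))"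
    using q(2) by (intro spnI[of "q - Poly_Mapping.single u ?c"]) auto
  then have "lead p ?c u"
    using u(1) q(1) by (auto simp: lead_def in_keys_iff below_def)
  then show thesis
    using that u(1) q(1) by (auto simp: below_def)
qed

lemma in_spn_below:
  assumes "Poly_Mapping.keys p \<subseteq> lists G"
  shows "p \<in> spn (below (Suc (\<Sum>u\<in>Poly_Mapping.keys p. wt u)))"
proof (rule spn_keys, rule subsetI)
  fix u assume "u \<in> Poly_Mapping.keys p"
  moreover from this have "wt u \<le> (\<Sum>u\<in>Poly_Mapping.keys p. wt u)"
    by (rule member_le_sum) simp_all
  ultimately show "u \<in> below (Suc (\<Sum>u\<in>Poly_Mapping.keys p. wt u))"
    unfolding below_def using assms by (simp add: subset_iff less_Suc_eq_le)
qed

lemma lead_exists: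
  assumes "Poly_Mapping.keys p \<subseteq> lists G" "p \<notin> I"
  obtains c u where "lead p c u"
  using that by (rule lead_exists_below[OF in_spn_below[OF assms(1)] assms(2)])

lemma lead_in_spn:
  assumes "lead p c u"
  shows "p \<in> spn (below (Suc (wt u)))"
proof -
  have "p - Poly_Mapping.single u c \<in> spn (below (Suc (wt u)))"
    using assms spn_mono[OF _ below_mono[of "wt u" "Suc (wt u)"]] by (simp add: lead_def)
  moreover have "Poly_Mapping.single u c \<in> spn (below (Suc (wt u)))"
    using assms by (intro spn_keys) (auto simp: below_def lead_def)
  ultimately show ?thesis
    using spn_add by fastforce
qed

text \<open>Otherwise the leading term would itself reduce to lower weight, against
  \<open>single_not_below\<close>. The weight of the leading word is thus an invariant of
  \<open>p\<close>.\<close>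

lemma lead_wt_le:
  assumes "lead p c u" "p \<in> spn (below m)"
  shows "wt u < m"
proof (rule ccontr)
  assume "\<not> wt u < m"
  then have "p \<in> spn (below (wt u))"
    using spn_mono[OF assms(2) below_mono[of m "wt u"]] by simp
  then have "p - (p - Poly_Mapping.single u c) \<in> spn (below (wt u))"
    using assms(1) spn_diff[OF _ _ below_lists] unfolding lead_def by blast
  then show False
    using single_not_below[of u c] assms(1) by (auto simp: lead_def)
qed

lemma lead_not_I: "lead p c u \<Longrightarrow> p \<notin> I"
  using lead_wt_le[of p c u 0] I_subset_spn by blast

lemma lead_unique:
  assumes "lead p c u" "lead p d v"
  obtains l where "mset u = mset v" "l \<in> L" "d = c * l"
proof -
  have wt: "wt u = wt v"
    using lead_wt_le[OF assms(1) lead_in_spn[OF assms(2)]] lead_wt_le[OF assms(2) lead_in_spn[OF assms(1)]] by simp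
  then have mset: "mset u = mset v"
    by (simp add: wt_eq_iff)
  obtain l where l: "l \<in> L" "Poly_Mapping.single u 1 - Poly_Mapping.single v l \<in> spn (below (wt u))"
    using rearrange[OF mset] assms(1) by (auto simp: lead_def)
  \<comment> \<open>Rewriting \<open>u\<close> in terms of \<open>v\<close> turns the difference of
    the two leading terms into one multiple of \<open>v\<close>, which has to vanish because
    everything else lies lower.\<close>
  have "Poly_Mapping.single v (d - c * l) = (p - Poly_Mapping.single u c) - (p - Poly_Mapping.single v d)
      + Poly_Mapping.single [] c * (Poly_Mapping.single u 1 - Poly_Mapping.single v l)"
    by (simp add: right_diff_distrib mult_single plus_list_def single_diff)
  also have "\<dots> \<in> spn (below (wt v))"
    using assms wt
    by (intro spn_add[OF spn_diff[OF _ _ below_lists] spn_scale[OF l(2)[unfolded wt] below_lists]])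
      (simp_all add: lead_def)
  finally have "d = c * l"
    using single_not_below[of v "d - c * l"] assms(2) by (simp add: lead_def)
  then show thesis
    using that mset l(1) by blast
qed

text \<open>Weights multiply under concatenation, so replacing either factor by its lower terms
  gives something below \<open>u @ v\<close>. In particular, \<open>S\<close> has no zero
  divisors.\<close>

lemma lead_mult:
  assumes "lead p c u" "lead q d v"
  shows "lead (p * q) (c * d) (u @ v)"
proof -
  have uv: "u \<in> lists G" "v \<in> lists G"
    using assms by (auto simp: lead_def)
  have "(p - Poly_Mapping.single u c) * q \<in> spn (below (wt (u @ v)))"
  proof (rule spn_mult[OF _ lead_in_spn[OF assms(2)] below_lists below_lists])
    show "p - Poly_Mapping.single u c \<in> spn (below (wt u))"
      using assms(1) by (simp add: lead_def)
    show "a @ b \<in> below (wt (u @ v))" if "a \<in> below (wt u)" "b \<in> below (Suc (wt v))" for a b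
      using that by (auto simp: below_def less_Suc_eq_le intro: mult_less_le_imp_less)
  qed
  moreover have "Poly_Mapping.single u c * (q - Poly_Mapping.single v d) \<in> spn (below (wt (u @ v)))"
  proof (rule spn_mult[OF _ _ _ below_lists])
    show "Poly_Mapping.single u c \<in> spn {u}"
      by (rule spn_keys) simp
    show "q - Poly_Mapping.single v d \<in> spn (below (wt v))"
      using assms(2) by (simp add: lead_def)
  qed (use uv in \<open>auto simp: below_def\<close>)
  ultimately have "(p - Poly_Mapping.single u c) * q + Poly_Mapping.single u c * (q - Poly_Mapping.single v d) \<in> spn (below (wt (u @ v)))"
    by (rule spn_add)
  then show ?thesis
    using assms by (simp add: lead_def algebra_simps mult_single plus_list_def)
qed

lemma lead_cong:
  assumes "lead p c u" "q - p \<in> I"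
  shows "lead q c u"
  using assms spn_add[OF I_subset_spn[OF assms(2)], of "p - Poly_Mapping.single u c"]
  by (simp add: lead_def)

lemma lead_single:
  assumes "u \<in> lists G" "c \<noteq> 0"
  shows "lead (Poly_Mapping.single u c) c u"
  using assms I_subset_spn[OF I_zero] by (simp add: lead_def)

lemma lead_add:
  assumes "lead p c u" "lead q d v" "lead (p + q) e w"
  shows "wt w \<le> max (wt u) (wt v)"
proof -
  have "p \<in> spn (below (Suc (max (wt u) (wt v))))" "q \<in> spn (below (Suc (max (wt u) (wt v))))"
    using lead_in_spn[OF assms(1)] lead_in_spn[OF assms(2)]
    by (auto intro!: below_mono elim!: spn_mono)
  then have "wt w < Suc (max (wt u) (wt v))"
    by (intro lead_wt_le[OF assms(3) spn_add])
  then show ?thesis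
    by simp
qed

end

section \<open>Leading coefficients in the skew field of fractions\<close>

lemma (in group) fraction_cancel:
  assumes "x \<in> carrier G" "y \<in> carrier G" "z \<in> carrier G"
  shows "x \<otimes> inv y \<otimes> (y \<otimes> z) = x \<otimes> z" "x \<otimes> z \<otimes> inv (y \<otimes> z) = x \<otimes> inv y"
proof -
  have "inv y \<otimes> (y \<otimes> z) = z" "z \<otimes> (inv z \<otimes> inv y) = inv y"
    using assms by (simp_all flip: m_assoc)
  then show "x \<otimes> inv y \<otimes> (y \<otimes> z) = x \<otimes> z" "x \<otimes> z \<otimes> inv (y \<otimes> z) = x \<otimes> inv y"
    using assms by (simp_all add: m_assoc inv_mult_group)
qed

text \<open>The multiplication rule for right fractions: \<open>ct\<close> says that
  \<open>inv b \<otimes> c\<close> equals \<open>s \<otimes> inv t\<close>.\<close>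

lemma (in group) fraction_mult:
  assumes "a \<in> carrier G" "b \<in> carrier G" "c \<in> carrier G" "d \<in> carrier G" "s \<in> carrier G" "t \<in> carrier G"
    and ct: "c \<otimes> t = b \<otimes> s"
  shows "a \<otimes> inv b \<otimes> (c \<otimes> inv d) = a \<otimes> s \<otimes> inv (d \<otimes> t)"
proof -
  have "c \<otimes> inv d = (b \<otimes> s) \<otimes> inv (d \<otimes> t)"
    using fraction_cancel(2)[of c d t] assms by simp
  also have "a \<otimes> inv b \<otimes> \<dots> = a \<otimes> inv b \<otimes> (b \<otimes> (s \<otimes> inv (d \<otimes> t)))"
    using assms(1,2,4-6) by (simp add: m_assoc)
  also have "\<dots> = a \<otimes> (s \<otimes> inv (d \<otimes> t))"
    using assms(1,2,4-6) by (intro fraction_cancel) simp_all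
  finally show ?thesis
    using assms(1,2,4-6) by (simp add: m_assoc)
qed

text \<open>Common multiples in \<open>M\<close> come for free: \<open>inv b\<close> times
  \<open>a\<close> is again a right fraction. Two fractions can then be compared over a common
  denominator, so sending \<open>a\<close> times \<open>inv b\<close> to \<open>f a\<close> times
  the inverse of \<open>f b\<close> is well defined.\<close>

lemma hom_extends_to_fractions:
  fixes U :: "('a, 'm) monoid_scheme" and H :: "('b, 'n) monoid_scheme"
  assumes "group U" "group H" and M: "M \<subseteq> carrier U" "\<And>x y. x \<in> M \<Longrightarrow> y \<in> M \<Longrightarrow> x \<otimes>\<^bsub>U\<^esub> y \<in> M"
    and frac: "\<And>u. u \<in> carrier U \<Longrightarrow> \<exists>a\<in>M. \<exists>b\<in>M. u = a \<otimes>\<^bsub>U\<^esub> inv\<^bsub>U\<^esub> b"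
    and f_closed: "\<And>x. x \<in> M \<Longrightarrow> f x \<in> carrier H"
    and f_mult: "\<And>x y. x \<in> M \<Longrightarrow> y \<in> M \<Longrightarrow> f (x \<otimes>\<^bsub>U\<^esub> y) = f x \<otimes>\<^bsub>H\<^esub> f y"
  shows "\<exists>F\<in>hom U H. \<forall>x\<in>M. F x = f x"
proof -
  interpret U: group U by fact
  interpret H: group H by fact
  have MU [simp]: "x \<in> M \<Longrightarrow> x \<in> carrier U" for x
    using M by auto
  note [simp] = M(2) f_closed f_mult
  have common: "\<exists>s\<in>M. \<exists>t\<in>M. a \<otimes>\<^bsub>U\<^esub> t = b \<otimes>\<^bsub>U\<^esub> s" if "a \<in> M" "b \<in> M" for a b
  proof -
    obtain s t where st: "s \<in> M" "t \<in> M" "inv\<^bsub>U\<^esub> b \<otimes>\<^bsub>U\<^esub> a = s \<otimes>\<^bsub>U\<^esub> inv\<^bsub>U\<^esub> t"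
      using frac[of "inv\<^bsub>U\<^esub> b \<otimes>\<^bsub>U\<^esub> a"] \<open>a \<in> M\<close> \<open>b \<in> M\<close> by auto
    have "a \<otimes>\<^bsub>U\<^esub> t = b \<otimes>\<^bsub>U\<^esub> (inv\<^bsub>U\<^esub> b \<otimes>\<^bsub>U\<^esub> a \<otimes>\<^bsub>U\<^esub> t)"
      using that st(1,2) by (simp flip: U.m_assoc)
    also have "\<dots> = b \<otimes>\<^bsub>U\<^esub> s"
      unfolding st(3) using that st by (simp add: U.m_assoc)
    finally show ?thesis using st by blast
  qed
  have well_def: "f a \<otimes>\<^bsub>H\<^esub> inv\<^bsub>H\<^esub> f b = f c \<otimes>\<^bsub>H\<^esub> inv\<^bsub>H\<^esub> f d"
    if in_M: "a \<in> M" "b \<in> M" "c \<in> M" "d \<in> M" and eq: "a \<otimes>\<^bsub>U\<^esub> inv\<^bsub>U\<^esub> b = c \<otimes>\<^bsub>U\<^esub> inv\<^bsub>U\<^esub> d" for a b c d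
  proof -
    obtain s t where st: "s \<in> M" "t \<in> M" "b \<otimes>\<^bsub>U\<^esub> t = d \<otimes>\<^bsub>U\<^esub> s"
      using common[OF in_M(2,4)] by auto
    have "a \<otimes>\<^bsub>U\<^esub> t = (a \<otimes>\<^bsub>U\<^esub> inv\<^bsub>U\<^esub> b) \<otimes>\<^bsub>U\<^esub> (b \<otimes>\<^bsub>U\<^esub> t)"
      using in_M st(1,2) by (simp add: U.fraction_cancel)
    also have "\<dots> = c \<otimes>\<^bsub>U\<^esub> s"
      unfolding eq st(3) using in_M st(1,2) by (simp add: U.fraction_cancel)
    finally have "f a \<otimes>\<^bsub>H\<^esub> f t = f c \<otimes>\<^bsub>H\<^esub> f s" "f b \<otimes>\<^bsub>H\<^esub> f t = f d \<otimes>\<^bsub>H\<^esub> f s"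
      using in_M st by (simp_all flip: f_mult)
    then have "(f a \<otimes>\<^bsub>H\<^esub> f t) \<otimes>\<^bsub>H\<^esub> inv\<^bsub>H\<^esub> (f b \<otimes>\<^bsub>H\<^esub> f t) = (f c \<otimes>\<^bsub>H\<^esub> f s) \<otimes>\<^bsub>H\<^esub> inv\<^bsub>H\<^esub> (f d \<otimes>\<^bsub>H\<^esub> f s)"
      by simp
    then show ?thesis
      using in_M st(1,2) by (simp add: H.fraction_cancel)
  qed
  define F where "F u = (SOME h. \<exists>a\<in>M. \<exists>b\<in>M. u = a \<otimes>\<^bsub>U\<^esub> inv\<^bsub>U\<^esub> b \<and> h = f a \<otimes>\<^bsub>H\<^esub> inv\<^bsub>H\<^esub> f b)" for u
  have F: "F (a \<otimes>\<^bsub>U\<^esub> inv\<^bsub>U\<^esub> b) = f a \<otimes>\<^bsub>H\<^esub> inv\<^bsub>H\<^esub> f b" if "a \<in> M" "b \<in> M" for a b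
    unfolding F_def by (rule some_equality) (use that well_def in metis)+
  have "F \<in> hom U H"
  proof (rule homI)
    fix u assume "u \<in> carrier U"
    then show "F u \<in> carrier H"
      using frac[of u] F by auto
  next
    fix u v assume "u \<in> carrier U" "v \<in> carrier U"
    then obtain a b c d where in_M: "a \<in> M" "b \<in> M" "c \<in> M" "d \<in> M"
      and uv: "u = a \<otimes>\<^bsub>U\<^esub> inv\<^bsub>U\<^esub> b" "v = c \<otimes>\<^bsub>U\<^esub> inv\<^bsub>U\<^esub> d"
      using frac by meson
    obtain s t where st: "s \<in> M" "t \<in> M" "c \<otimes>\<^bsub>U\<^esub> t = b \<otimes>\<^bsub>U\<^esub> s"
      using common[OF in_M(3,2)] by auto
    have fst: "f c \<otimes>\<^bsub>H\<^esub> f t = f b \<otimes>\<^bsub>H\<^esub> f s"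
      using in_M st by (simp flip: f_mult)
    have "u \<otimes>\<^bsub>U\<^esub> v = (a \<otimes>\<^bsub>U\<^esub> s) \<otimes>\<^bsub>U\<^esub> inv\<^bsub>U\<^esub> (d \<otimes>\<^bsub>U\<^esub> t)"
      unfolding uv using in_M st by (intro U.fraction_mult) simp_all
    moreover have "f a \<otimes>\<^bsub>H\<^esub> inv\<^bsub>H\<^esub> f b \<otimes>\<^bsub>H\<^esub> (f c \<otimes>\<^bsub>H\<^esub> inv\<^bsub>H\<^esub> f d) = f (a \<otimes>\<^bsub>U\<^esub> s) \<otimes>\<^bsub>H\<^esub> inv\<^bsub>H\<^esub> f (d \<otimes>\<^bsub>U\<^esub> t)"
      using H.fraction_mult[OF _ _ _ _ _ _ fst, of "f a" "f d"] in_M st by simp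
    ultimately show "F (u \<otimes>\<^bsub>U\<^esub> v) = F u \<otimes>\<^bsub>H\<^esub> F v"
      using F[of "a \<otimes>\<^bsub>U\<^esub> s" "d \<otimes>\<^bsub>U\<^esub> t"] F[of a b] F[of c d] in_M st uv by simp
  qed
  \<comment> \<open>Since \<open>M\<close> need not contain the identity, \<open>x\<close> is
    written as the fraction with numerator \<open>x\<close> squared and denominator
    \<open>x\<close>.\<close>
  moreover have "F x = f x" if "x \<in> M" for x
    using F[of "x \<otimes>\<^bsub>U\<^esub> x" x] that by (simp add: U.m_assoc H.m_assoc)
  ultimately show ?thesis
    by blast
qed

text \<open>Here \<open>\<theta>\<close> stands for the quotient map to \<open>S\<close> followed by
  the embedding, so that fractions are written with elements of the free algebra instead of cosets;
  injectivity of the embedding becomes the description of the kernel.\<close>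

locale quantum_weyl_fractions = quantum_weyl n r \<Lambda>
  for n r :: nat and \<Lambda> :: "nat \<Rightarrow> nat \<Rightarrow> 'k::field_char_0" +
  fixes D :: "('d, 'm) ring_scheme" (structure) and \<theta> :: "(generator list \<Rightarrow>\<^sub>0 'k) \<Rightarrow> 'd"
  assumes skew_field: "skew_field D"
    and theta_closed: "Poly_Mapping.keys p \<subseteq> lists G \<Longrightarrow> \<theta> p \<in> carrier D"
    and theta_add: "Poly_Mapping.keys p \<subseteq> lists G \<Longrightarrow> Poly_Mapping.keys q \<subseteq> lists G \<Longrightarrow> \<theta> (p + q) = \<theta> p \<oplus> \<theta> q"
    and theta_mult: "Poly_Mapping.keys p \<subseteq> lists G \<Longrightarrow> Poly_Mapping.keys q \<subseteq> lists G \<Longrightarrow> \<theta> (p * q) = \<theta> p \<otimes> \<theta> q"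
    and theta_one: "\<theta> 1 = \<one>"
    and theta_eq_zero: "Poly_Mapping.keys p \<subseteq> lists G \<Longrightarrow> \<theta> p = \<zero> \<longleftrightarrow> p \<in> I"
    and fraction: "d \<in> carrier D \<Longrightarrow> \<exists>a b. Poly_Mapping.keys a \<subseteq> lists G \<and> Poly_Mapping.keys b \<subseteq> lists G \<and> b \<notin> I
      \<and> d = \<theta> a \<otimes> inv \<theta> b"
begin

sublocale ring D
  using skew_field by (simp add: skew_field_def)

lemma Units_D: "Units D = carrier D - {\<zero>}"
  using skew_field by (simp add: skew_field_def)

sublocale U: group "units_of D"
  by (rule units_group)

lemma keys_single_lists: "u \<in> lists G \<Longrightarrow> Poly_Mapping.keys (Poly_Mapping.single u c) \<subseteq> lists G"
  by simp

lemmas free_algebra_closed = free_algebra_mult_closed free_algebra_add_closed keys_single_lists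

abbreviation "K \<equiv> units_of (univ_ring :: 'k ring)"

lemma theta_zero: "\<theta> 0 = \<zero>"
  using theta_eq_zero[of 0] I_zero by simp

lemma theta_uminus:
  assumes "Poly_Mapping.keys p \<subseteq> lists G"
  shows "\<theta> (- p) = \<ominus> \<theta> p"
  using theta_add[of "- p" p] assms theta_closed[of p] theta_closed[of "- p"] theta_zero
  by (intro minus_equality[symmetric]) auto

lemma minus_zero_iff:
  assumes "x \<in> carrier D" "y \<in> carrier D"
  shows "x \<ominus> y = \<zero> \<longleftrightarrow> x = y"
  using assms by (metis add.inv_solve_right' l_zero minus_eq r_neg zero_closed a_inv_closed)

lemma theta_eq_iff:
  assumes "Poly_Mapping.keys p \<subseteq> lists G" "Poly_Mapping.keys q \<subseteq> lists G"
  shows "\<theta> p = \<theta> q \<longleftrightarrow> p - q \<in> I"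
proof -
  have "\<theta> (p - q) = \<theta> p \<ominus> \<theta> q"
    using theta_add[of p "- q"] theta_uminus assms by (simp add: a_minus_def)
  moreover have "Poly_Mapping.keys (p - q) \<subseteq> lists G"
    using free_algebra_add_closed[of p G "- q"] assms by simp
  ultimately show ?thesis
    using theta_eq_zero[of "p - q"] theta_closed[OF assms(1)] theta_closed[OF assms(2)] minus_zero_iff by simp
qed

lemma lead_carrier: "lead p c u \<Longrightarrow> Poly_Mapping.keys p \<subseteq> lists G"
  using spn_carrier[OF lead_in_spn below_lists] .

lemma theta_Units: "Poly_Mapping.keys p \<subseteq> lists G \<Longrightarrow> p \<notin> I \<Longrightarrow> \<theta> p \<in> Units D"
  using theta_closed theta_eq_zero by (simp add: Units_D)

lemma lead_Units: "lead p c u \<Longrightarrow> \<theta> p \<in> Units D"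
  using theta_Units lead_carrier lead_not_I by blast

text \<open>Serves twice, with the class of \<open>c\<close> modulo \<open>L\<close> and with the
  weight of \<open>u\<close> as value. By \<open>cong\<close>, \<open>f\<close> is blind to the
  ambiguity left by \<open>lead_unique\<close>, so its value depends on the element alone.\<close>

lemma lead_hom_extends:
  fixes H :: "('h, 'n) monoid_scheme"
  assumes H: "group H"
    and closed: "\<And>c u. c \<noteq> 0 \<Longrightarrow> u \<in> lists G \<Longrightarrow> f c u \<in> carrier H"
    and mult: "\<And>c u d v. c \<noteq> 0 \<Longrightarrow> u \<in> lists G \<Longrightarrow> d \<noteq> 0 \<Longrightarrow> v \<in> lists G \<Longrightarrow> f (c * d) (u @ v) = f c u \<otimes>\<^bsub>H\<^esub> f d v"
    and cong: "\<And>c u l v. c \<noteq> 0 \<Longrightarrow> l \<in> L \<Longrightarrow> mset u = mset v \<Longrightarrow> f (c * l) v = f c u"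
  shows "\<exists>F\<in>hom (units_of D) H. \<forall>p c u. lead p c u \<longrightarrow> F (\<theta> p) = f c u"
proof -
  define M where "M = \<theta> ` {p. Poly_Mapping.keys p \<subseteq> lists G \<and> p \<notin> I}"
  define g where "g x = (SOME h. \<exists>p c u. lead p c u \<and> x = \<theta> p \<and> h = f c u)" for x
  have uniq: "f c u = f d v" if "lead p c u" "lead q d v" "\<theta> p = \<theta> q" for p q c d u v
  proof -
    have "p - q \<in> I"
      using that theta_eq_iff lead_carrier by blast
    then have "lead p d v"
      using lead_cong[OF that(2)] by blast
    from that(1) this obtain l where "mset u = mset v" "l \<in> L" "d = c * l"
      by (rule lead_unique)
    then show ?thesis
      using cong[of c l u v] that(1) by (simp add: lead_def)
  qed
  have g: "g (\<theta> p) = f c u" if "lead p c u" for p c u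
    unfolding g_def by (rule some_equality) (use that uniq in metis)+
  have M_lead: "\<exists>p c u. lead p c u \<and> x = \<theta> p" if "x \<in> M" for x
  proof -
    obtain p where p: "Poly_Mapping.keys p \<subseteq> lists G" "p \<notin> I" "x = \<theta> p"
      using \<open>x \<in> M\<close> by (auto simp: M_def)
    from p(1,2) obtain c u where "lead p c u"
      by (rule lead_exists)
    then show ?thesis
      using p(3) by blast
  qed
  have lead_M: "\<theta> p \<in> M" if "lead p c u" for p c u
    using lead_carrier[OF that] lead_not_I[OF that] unfolding M_def by blast
  have "\<exists>F\<in>hom (units_of D) H. \<forall>x\<in>M. F x = g x"
  proof (rule hom_extends_to_fractions[OF U.group_axioms H])
    show "M \<subseteq> carrier (units_of D)"
      using M_lead lead_Units by (auto simp: units_of_carrier)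
    fix x y assume "x \<in> M" "y \<in> M"
    then obtain p c u q d v where *: "lead p c u" "x = \<theta> p" "lead q d v" "y = \<theta> q"
      using M_lead by meson
    then have xy: "x \<otimes>\<^bsub>units_of D\<^esub> y = \<theta> (p * q)"
      by (simp add: units_of_mult theta_mult lead_carrier)
    then show "x \<otimes>\<^bsub>units_of D\<^esub> y \<in> M"
      using lead_M lead_mult[OF *(1,3)] by simp
    show "g (x \<otimes>\<^bsub>units_of D\<^esub> y) = g x \<otimes>\<^bsub>H\<^esub> g y"
      unfolding xy using g[OF lead_mult[OF *(1,3)]] g * mult[of c u d v] by (simp add: lead_def)
  next
    fix x assume "x \<in> M"
    then show "g x \<in> carrier H"
      using M_lead g closed by (metis lead_def)
  next
    fix x assume "x \<in> carrier (units_of D)"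
    then have x: "x \<in> carrier D" "x \<noteq> \<zero>"
      by (auto simp: units_of_carrier Units_D)
    obtain a b where ab: "Poly_Mapping.keys a \<subseteq> lists G" "Poly_Mapping.keys b \<subseteq> lists G" "b \<notin> I" "x = \<theta> a \<otimes> inv \<theta> b"
      using fraction[OF x(1)] by blast
    have "a \<notin> I"
      using x ab theta_eq_zero[of a] theta_Units[of b] by auto
    then show "\<exists>a\<in>M. \<exists>b\<in>M. x = a \<otimes>\<^bsub>units_of D\<^esub> inv\<^bsub>units_of D\<^esub> b"
      using ab theta_Units[OF ab(2,3)] unfolding M_def
      by (intro bexI[of _ "\<theta> a"] bexI[of _ "\<theta> b"]) (simp_all add: units_of_mult units_of_inv)
  qed
  then show ?thesis
    using lead_M g by metis
qed

section \<open>Scalars in the skew field and the trace of the derived group\<close>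

definition \<eta> :: "'k \<Rightarrow> 'd" where
  "\<eta> c = \<theta> (Poly_Mapping.single [] c)"

lemma eta_closed [simp]: "\<eta> c \<in> carrier D"
  unfolding \<eta>_def by (rule theta_closed) simp

lemma eta_mult: "\<eta> (c * d) = \<eta> c \<otimes> \<eta> d"
proof -
  have "Poly_Mapping.single ([] :: generator list) (c * d) = Poly_Mapping.single [] c * Poly_Mapping.single [] d"
    by (simp add: mult_single plus_list_def)
  moreover have "\<theta> (Poly_Mapping.single [] c * Poly_Mapping.single [] d) = \<eta> c \<otimes> \<eta> d"
    unfolding \<eta>_def by (intro theta_mult free_algebra_closed) simp_all
  ultimately show ?thesis
    by (simp only: \<eta>_def)
qed

lemma eta_add: "\<eta> (c + d) = \<eta> c \<oplus> \<eta> d"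
  by (simp add: \<eta>_def single_add theta_add)

lemma eta_one [simp]: "\<eta> 1 = \<one>"
  using theta_one by (simp add: \<eta>_def flip: zero_list_def)

lemma eta_zero [simp]: "\<eta> 0 = \<zero>"
  by (simp add: \<eta>_def theta_zero)

lemma lead_const: "c \<noteq> 0 \<Longrightarrow> lead (Poly_Mapping.single [] c) c []"
  by (rule lead_single) auto

lemma derived_eta_in_L:
  assumes "c \<noteq> 0" "\<eta> c \<in> derived (units_of D) (Units D)"
  shows "c \<in> L"
proof -
  interpret K: comm_group K by (rule comm_group_units_univ_ring)
  interpret L: subgroup L K by (rule subgroup_L)
  have norm: "L \<lhd> K"
    by (rule K.subgroup_imp_normal[OF subgroup_L])
  interpret Q: comm_group "K Mod L"
    by (rule K.abelian_FactGroup[OF subgroup_L])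
  have "\<exists>F\<in>hom (units_of D) (K Mod L). \<forall>p c u. lead p c u \<longrightarrow> F (\<theta> p) = L #>\<^bsub>K\<^esub> c"
  proof (rule lead_hom_extends)
    show "group (K Mod L)" ..
    fix c :: 'k assume "c \<noteq> 0"
    then show "L #>\<^bsub>K\<^esub> c \<in> carrier (K Mod L)"
      by (auto simp: FactGroup_def carrier_units_univ_ring RCOSETS_def)
  next
    fix c d :: 'k assume "c \<noteq> 0" "d \<noteq> 0"
    then show "L #>\<^bsub>K\<^esub> (c * d) = (L #>\<^bsub>K\<^esub> c) \<otimes>\<^bsub>K Mod L\<^esub> (L #>\<^bsub>K\<^esub> d)"
      using normal.rcos_sum[OF norm, of c d] by (simp add: carrier_units_univ_ring mult_units_univ_ring)
  next
    fix c l :: 'k assume "c \<noteq> 0" "l \<in> L"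
    then have "c * l \<in> L #>\<^bsub>K\<^esub> c"
      by (auto simp: r_coset_def mult_units_univ_ring mult.commute)
    then show "L #>\<^bsub>K\<^esub> (c * l) = L #>\<^bsub>K\<^esub> c"
      using K.repr_independence[OF _ _ subgroup_L, of "c * l" c] \<open>c \<noteq> 0\<close> by (simp add: carrier_units_univ_ring)
  qed
  then obtain F where F: "F \<in> hom (units_of D) (K Mod L)" "\<And>p c u. lead p c u \<Longrightarrow> F (\<theta> p) = L #>\<^bsub>K\<^esub> c"
    by blast
  interpret F: group_hom "units_of D" "K Mod L" F
    using F(1) by unfold_locales
  have "F ` derived (units_of D) (Units D) = derived (K Mod L) (F ` Units D)"
    by (rule F.derived_img[symmetric]) (simp add: units_of_carrier)
  also have "\<dots> = {\<one>\<^bsub>K Mod L\<^esub>}"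
    by (rule Q.derived_eq_singleton) (use F.hom_closed in \<open>auto simp: units_of_carrier\<close>)
  finally have "F (\<eta> c) = L"
    using assms(2) by auto
  then have "L #>\<^bsub>K\<^esub> c = L"
    using F(2)[OF lead_const[OF assms(1)]] by (simp add: \<eta>_def)
  moreover have "c \<in> L #>\<^bsub>K\<^esub> c"
    using L_one by (force simp: r_coset_def mult_units_univ_ring)
  ultimately show ?thesis
    by simp
qed

text \<open>The parameter is the group commutator of \<open>y_i\<close> and
  \<open>y_j\<close>.\<close>

lemma lam_in_derived:
  assumes "i \<in> {1..n}" "j \<in> {1..n}"
  shows "\<eta> (\<Lambda> i j) \<in> derived (units_of D) (Units D)"
proof -
  let ?y = "\<lambda>i. \<theta> (Poly_Mapping.single [Gen_y i] 1)"
  have G: "Gen_y i \<in> G" "Gen_y j \<in> G"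
    using assms by (auto simp: S_gens_def)
  have y: "?y i \<in> Units D" "?y j \<in> Units D"
    using G by (auto intro!: lead_Units lead_single)
  have "y_gen i * y_gen j - scalar (\<Lambda> i j) * y_gen j * y_gen i \<in> I"
    using assms by (intro relators_I) (unfold S_relators_def, blast)
  then have "Poly_Mapping.single [Gen_y i] 1 * Poly_Mapping.single [Gen_y j] 1
      - Poly_Mapping.single [] (\<Lambda> i j) * (Poly_Mapping.single [Gen_y j] 1 * Poly_Mapping.single [Gen_y i] 1) \<in> I"
    by (simp only: gen_def scalar_def mult.assoc)
  then have "\<theta> (Poly_Mapping.single [Gen_y i] 1 * Poly_Mapping.single [Gen_y j] 1)
      = \<theta> (Poly_Mapping.single [] (\<Lambda> i j) * (Poly_Mapping.single [Gen_y j] 1 * Poly_Mapping.single [Gen_y i] 1))"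
    using G by (subst theta_eq_iff) (simp_all add: free_algebra_closed)
  then have *: "?y i \<otimes> ?y j = \<eta> (\<Lambda> i j) \<otimes> (?y j \<otimes> ?y i)"
    using G by (simp add: theta_mult \<eta>_def free_algebra_closed)
  have "\<eta> (\<Lambda> i j) = ?y i \<otimes> ?y j \<otimes> inv ?y i \<otimes> inv ?y j"
  proof -
    have "?y i \<otimes> (inv ?y i \<otimes> inv ?y j) = inv ?y j"
      using y by (simp add: Units_closed flip: m_assoc)
    then show ?thesis
      unfolding * using y by (simp add: Units_closed m_assoc)
  qed
  also have "\<dots> = ?y i \<otimes>\<^bsub>units_of D\<^esub> ?y j \<otimes>\<^bsub>units_of D\<^esub> inv\<^bsub>units_of D\<^esub> ?y i \<otimes>\<^bsub>units_of D\<^esub> inv\<^bsub>units_of D\<^esub> ?y j"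
    using y by (simp add: units_of_mult units_of_inv)
  finally show ?thesis
    unfolding derived_def using y by (intro generate.incl) blast
qed

lemma L_eta_in_derived:
  assumes "c \<in> L"
  shows "\<eta> c \<in> derived (units_of D) (Units D)"
  using assms unfolding L_def
proof induction
  case one
  then show ?case
    unfolding derived_def one_units_univ_ring eta_one units_of_one[of D, symmetric] by (rule generate.one)
next
  case (incl h)
  then show ?case using lam_in_derived by blast
next
  case (inv h)
  then obtain i j where "i \<in> {1..n}" "j \<in> {1..n}" "h = \<Lambda> i j"
    by blast
  then show ?case
    using lam_in_derived[of j i] inv_units_univ_ring[OF lam_nz[of i j]] lam_inv[of i j] by simp
next
  case (eng c d)
  then show ?case
    unfolding derived_def mult_units_univ_ring eta_mult units_of_mult[of D, symmetric] by (intro generate.eng)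
qed

lemma G_trace_eq: "G_trace D \<eta> = L"
  using derived_eta_in_L L_eta_in_derived L_nz by (auto simp: G_trace_def)

text \<open>The additive commutator of \<open>x_1\<close> and \<open>y_1\<close> is 1, and the
  derived Lie algebra is closed under scalars.\<close>

lemma E_trace_eq_UNIV:
  assumes "1 \<le> r"
  shows "E_trace D \<eta> = UNIV"
proof -
  let ?x = "Poly_Mapping.single [Gen_x 1] 1" and ?y = "Poly_Mapping.single [Gen_y 1] 1"
  have G: "Gen_x 1 \<in> G" "Gen_y 1 \<in> G"
    using assms r_le by (auto simp: S_gens_def)
  have "x_gen 1 * y_gen 1 - (y_gen 1 * x_gen 1 + 1) \<in> I"
  proof -
    have "1 \<in> {1..r}" using assms by simp
    then show ?thesis
      by (intro relators_I) (unfold S_relators_def, blast)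
  qed
  then have "?x * ?y - (?y * ?x + Poly_Mapping.single [] 1) \<in> I"
    by (simp add: gen_def scalar_one[symmetric] scalar_def)
  then have "\<theta> (?x * ?y) = \<theta> (?y * ?x + Poly_Mapping.single [] 1)"
    using G by (subst theta_eq_iff) (simp_all add: free_algebra_closed)
  then have xy: "\<theta> ?x \<otimes> \<theta> ?y = \<theta> ?y \<otimes> \<theta> ?x \<oplus> \<one>"
    using G eta_one by (simp add: theta_mult theta_add free_algebra_closed \<eta>_def)
  have closed: "\<theta> ?x \<in> carrier D" "\<theta> ?y \<in> carrier D"
    using G by (auto intro!: theta_closed)
  have "\<eta> c \<in> lie_derived D \<eta>" for c
  proof -
    have "\<theta> ?x \<otimes> \<theta> ?y \<ominus> \<theta> ?y \<otimes> \<theta> ?x = \<one>"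
      unfolding xy using closed by (simp add: minus_eq a_comm[of _ \<one>] a_assoc r_neg)
    then have "\<eta> c = \<eta> c \<otimes> (\<theta> ?x \<otimes> \<theta> ?y \<ominus> \<theta> ?y \<otimes> \<theta> ?x)"
      by simp
    then show ?thesis
      unfolding lie_derived_def using closed by (intro generate.incl) blast
  qed
  then show ?thesis
    by (auto simp: E_trace_def)
qed

end

section \<open>The absolute value and the case of quantum affine space\<close>

context quantum_weyl_fractions
begin

lemma norm_exists:
  "\<exists>F\<in>hom (units_of D) (units_of (univ_ring :: real ring)). \<forall>p c u. lead p c u \<longrightarrow> F (\<theta> p) = real (wt u)"
proof (rule lead_hom_extends)
  show "group (units_of (univ_ring :: real ring))"
    using comm_group_units_univ_ring comm_group.axioms(2) by blast
qed (auto simp: carrier_units_univ_ring mult_units_univ_ring wt_pos[THEN less_imp_neq, symmetric] simp flip: wt_eq_iff)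

text \<open>\<open>norm_exists\<close> provides the homomorphism selected by \<open>SOME\<close>.
  Real values accommodate quotients of weights and permit limits; the value 0 at zero makes the norm
  multiplicative everywhere.\<close>

definition nrm :: "'d \<Rightarrow> real" where
  "nrm x = (if x = \<zero> then 0 else (SOME F. F \<in> hom (units_of D) (units_of (univ_ring :: real ring))
      \<and> (\<forall>p c u. lead p c u \<longrightarrow> F (\<theta> p) = real (wt u))) x)"

lemma nrm_zero [simp]: "nrm \<zero> = 0"
  by (simp add: nrm_def)

lemma
  shows nrm_lead: "lead p c u \<Longrightarrow> nrm (\<theta> p) = real (wt u)"
    and nrm_mult: "x \<in> carrier D \<Longrightarrow> y \<in> carrier D \<Longrightarrow> nrm (x \<otimes> y) = nrm x * nrm y"
proof -
  obtain F where F: "F \<in> hom (units_of D) (units_of (univ_ring :: real ring))"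
      "\<And>p c u. lead p c u \<Longrightarrow> F (\<theta> p) = real (wt u)"
    and nrm: "\<And>x. nrm x = (if x = \<zero> then 0 else F x)"
  proof -
    have "\<exists>F. F \<in> hom (units_of D) (units_of (univ_ring :: real ring)) \<and> (\<forall>p c u. lead p c u \<longrightarrow> F (\<theta> p) = real (wt u))"
      using norm_exists by blast
    from someI_ex[OF this] show thesis
      by (intro that) (auto simp: nrm_def)
  qed
  show "nrm (\<theta> p) = real (wt u)" if "lead p c u"
    using lead_Units[OF that] F(2)[OF that] by (simp add: nrm Units_D)
  show "nrm (x \<otimes> y) = nrm x * nrm y" if xy: "x \<in> carrier D" "y \<in> carrier D"
  proof (cases "x = \<zero> \<or> y = \<zero>")
    case False
    then have "x \<in> Units D" "y \<in> Units D"
      using xy by (auto simp: Units_D)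
    moreover from this have "x \<otimes> y \<in> Units D"
      by (rule Units_m_closed)
    ultimately show ?thesis
      using hom_mult[OF F(1), of x y, unfolded mult_units_univ_ring]
      by (simp add: nrm Units_D units_of_carrier units_of_mult)
  qed (use xy in auto)
qed

lemma nrm_eta: "c \<noteq> 0 \<Longrightarrow> nrm (\<eta> c) = 1"
  using nrm_lead[OF lead_const] by (simp add: \<eta>_def)

lemma nrm_one [simp]: "nrm \<one> = 1"
  using nrm_eta[of 1] by simp

lemma nrm_theta_pos:
  assumes "Poly_Mapping.keys p \<subseteq> lists G" "p \<notin> I"
  shows "nrm (\<theta> p) > 0"
proof -
  from assms obtain c u where "lead p c u"
    by (rule lead_exists)
  then show ?thesis
    by (simp add: nrm_lead)
qed

lemma nrm_pos:
  assumes x: "x \<in> carrier D" "x \<noteq> \<zero>"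
  shows "nrm x > 0"
proof -
  obtain a b where ab: "Poly_Mapping.keys a \<subseteq> lists G" "Poly_Mapping.keys b \<subseteq> lists G" "b \<notin> I" "x = \<theta> a \<otimes> inv \<theta> b"
    using fraction[OF x(1)] by blast
  have b: "\<theta> b \<in> Units D"
    by (rule theta_Units[OF ab(2,3)])
  have "a \<notin> I"
    using x ab theta_eq_zero[of a] b by auto
  have "x \<otimes> \<theta> b = \<theta> a"
    unfolding ab(4) using b theta_closed[OF ab(1)] by (simp add: m_assoc Units_closed)
  then have "nrm x * nrm (\<theta> b) = nrm (\<theta> a)"
    using nrm_mult[OF x(1), of "\<theta> b"] b by (simp add: Units_closed)
  then show ?thesis
    using nrm_theta_pos[OF ab(1) \<open>a \<notin> I\<close>] nrm_theta_pos[OF ab(2,3)] by (metis zero_less_mult_pos2)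
qed

lemma nrm_nonneg: "x \<in> carrier D \<Longrightarrow> nrm x \<ge> 0"
  using nrm_pos[of x] by (cases "x = \<zero>") auto

lemma nrm_eq_zero: "x \<in> carrier D \<Longrightarrow> nrm x = 0 \<longleftrightarrow> x = \<zero>"
  using nrm_pos[of x] by (cases "x = \<zero>") auto

lemma uminus_eta: "x \<in> carrier D \<Longrightarrow> \<ominus> x = \<eta> (- 1) \<otimes> x"
proof -
  have "\<eta> (- 1) \<oplus> \<one> = \<zero>"
    using eta_add[of "- 1" 1] by simp
  then have "\<eta> (- 1) = \<ominus> \<one>"
    by (intro minus_equality[symmetric]) auto
  then show "x \<in> carrier D \<Longrightarrow> \<ominus> x = \<eta> (- 1) \<otimes> x"
    by (simp add: l_minus)
qed

lemma nrm_uminus: "x \<in> carrier D \<Longrightarrow> nrm (\<ominus> x) = nrm x"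
  by (simp add: uminus_eta nrm_mult nrm_eta)

lemma nrm_theta_add:
  assumes p: "Poly_Mapping.keys p \<subseteq> lists G" and q: "Poly_Mapping.keys q \<subseteq> lists G"
  shows "nrm (\<theta> p \<oplus> \<theta> q) \<le> max (nrm (\<theta> p)) (nrm (\<theta> q))"
proof -
  consider "p \<in> I" | "q \<in> I" | "p + q \<in> I" | "p \<notin> I" "q \<notin> I" "p + q \<notin> I"
    by blast
  then show ?thesis
  proof cases
    case 1
    then show ?thesis
      using theta_eq_zero[OF p] theta_closed[OF q] by simp
  next
    case 2
    then show ?thesis
      using theta_eq_zero[OF q] theta_closed[OF p] by simp
  next
    case 3
    then show ?thesis
      using theta_eq_zero[OF free_algebra_add_closed[OF p q]] theta_add[OF p q] nrm_nonneg[OF theta_closed[OF p]]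
      by (simp add: max_def)
  next
    case 4
    obtain c u where u: "lead p c u" using lead_exists[OF p 4(1)] .
    obtain d v where v: "lead q d v" using lead_exists[OF q 4(2)] .
    obtain e w where w: "lead (p + q) e w" using lead_exists[OF free_algebra_add_closed[OF p q] 4(3)] .
    show ?thesis
      using lead_add[OF u v w] unfolding theta_add[OF p q, symmetric] nrm_lead[OF u] nrm_lead[OF v] nrm_lead[OF w] 
      by (simp add: max_def split: if_splits)
  qed
qed

text \<open>Multiplying by the denominator of \<open>x\<close> reduces the claim to the ultrametric
  inequality for \<open>S\<close>, that is to \<open>nrm_theta_add\<close>.\<close>

lemma nrm_one_add:
  assumes x: "x \<in> carrier D"
  shows "nrm (\<one> \<oplus> x) \<le> max 1 (nrm x)"
proof -
  obtain a b where ab: "Poly_Mapping.keys a \<subseteq> lists G" "Poly_Mapping.keys b \<subseteq> lists G" "b \<notin> I" "x = \<theta> a \<otimes> inv \<theta> b"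
    using fraction[OF x(1)] by blast
  have b: "\<theta> b \<in> Units D" "\<theta> b \<in> carrier D"
    using theta_Units[OF ab(2,3)] by (auto simp: Units_closed)
  have pos: "nrm (\<theta> b) > 0"
    by (rule nrm_theta_pos[OF ab(2,3)])
  have xb: "x \<otimes> \<theta> b = \<theta> a"
    unfolding ab(4) using b theta_closed[OF ab(1)] by (simp add: m_assoc)
  then have "(\<one> \<oplus> x) \<otimes> \<theta> b = \<theta> b \<oplus> \<theta> a"
    using x b by (simp add: l_distr)
  then have "nrm (\<one> \<oplus> x) * nrm (\<theta> b) \<le> max (nrm (\<theta> b)) (nrm (\<theta> a))"
    using nrm_mult[of "\<one> \<oplus> x" "\<theta> b"] nrm_theta_add[OF ab(2,1)] x b by simp
  also have "\<dots> = max 1 (nrm x) * nrm (\<theta> b)"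
    using nrm_mult[OF x b(2)] xb pos by (simp add: max_mult_distrib_right)
  finally show ?thesis
    using pos by simp
qed

text \<open>Factoring out \<open>x\<close> leaves a sum of the form 1 plus one fraction, so two
  fractions never have to be brought over a common denominator.\<close>

lemma nrm_add:
  assumes x: "x \<in> carrier D" and y: "y \<in> carrier D"
  shows "nrm (x \<oplus> y) \<le> max (nrm x) (nrm y)"
proof (cases "x = \<zero>")
  case False
  then have xU: "x \<in> Units D"
    using x by (simp add: Units_D)
  then have "x \<oplus> y = x \<otimes> (\<one> \<oplus> inv x \<otimes> y)"
  proof -
    have "x \<otimes> (inv x \<otimes> y) = y"
      using xU x y by (simp flip: m_assoc)
    then show ?thesis
      using xU x y by (simp add: r_distr)
  qed
  then have "nrm (x \<oplus> y) = nrm x * nrm (\<one> \<oplus> inv x \<otimes> y)"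
    using xU x y by (simp add: nrm_mult)
  also have "\<dots> \<le> nrm x * max 1 (nrm (inv x \<otimes> y))"
    using nrm_one_add[of "inv x \<otimes> y"] nrm_nonneg[OF x] xU y by (intro mult_left_mono) auto
  also have "\<dots> = max (nrm x) (nrm (x \<otimes> (inv x \<otimes> y)))"
    using nrm_nonneg[OF x] xU x y by (simp add: nrm_mult max_mult_distrib_left)
  also have "x \<otimes> (inv x \<otimes> y) = y"
    using xU x y by (simp flip: m_assoc)
  finally show ?thesis .
qed (use y nrm_nonneg[OF y] in simp)

lemma nrm_diff: "x \<in> carrier D \<Longrightarrow> y \<in> carrier D \<Longrightarrow> nrm (x \<ominus> y) \<le> max (nrm x) (nrm y)"
  using nrm_add[of x "\<ominus> y"] by (simp add: minus_eq nrm_uminus)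

lemma add_diff_cancel: "x \<in> carrier D \<Longrightarrow> y \<in> carrier D \<Longrightarrow> x \<oplus> y \<ominus> x = y"
  by (simp add: minus_eq a_comm[of x y] a_assoc r_neg)

text \<open>The isosceles principle of ultrametric spaces: the smaller summand cannot cancel the
  larger one.\<close>

lemma nrm_add_eq_max:
  assumes x: "x \<in> carrier D" and y: "y \<in> carrier D" and neq: "nrm x \<noteq> nrm y"
  shows "nrm (x \<oplus> y) = max (nrm x) (nrm y)"
proof -
  have "y \<oplus> x \<ominus> y = x" "x \<oplus> y \<ominus> x = y"
    using x y by (simp_all add: add_diff_cancel)
  then have "nrm x \<le> max (nrm (x \<oplus> y)) (nrm y)" "nrm y \<le> max (nrm (x \<oplus> y)) (nrm x)"
    using nrm_diff[of "y \<oplus> x" y] nrm_diff[of "x \<oplus> y" x] x y by (simp_all add: a_comm[of y x])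
  then show ?thesis
    using nrm_add[OF x y] neq by linarith
qed

lemma Units_r_cancel:
  assumes "u \<in> Units D" "x \<in> carrier D" "y \<in> carrier D" "x \<otimes> u = y \<otimes> u"
  shows "x = y"
proof -
  have "x \<otimes> u \<otimes> inv u = y \<otimes> u \<otimes> inv u"
    using assms(4) by simp
  then show ?thesis
    using assms(1-3) by (simp add: m_assoc Units_closed)
qed

text \<open>Scalars commute with the image of the free algebra; clearing the denominator extends
  this to fractions.\<close>

lemma eta_central:
  assumes x: "x \<in> carrier D"
  shows "\<eta> c \<otimes> x = x \<otimes> \<eta> c"
proof -
  have central: "\<eta> c \<otimes> \<theta> p = \<theta> p \<otimes> \<eta> c" if "Poly_Mapping.keys p \<subseteq> lists G" for p
    using scalar_central[of c p] that
    by (simp add: \<eta>_def scalar_def flip: theta_mult)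
  obtain a b where ab: "Poly_Mapping.keys a \<subseteq> lists G" "Poly_Mapping.keys b \<subseteq> lists G" "b \<notin> I" "x = \<theta> a \<otimes> inv \<theta> b"
    using fraction[OF x(1)] by blast
  have a: "\<theta> a \<in> carrier D" and b: "\<theta> b \<in> Units D" "\<theta> b \<in> carrier D"
    using theta_Units[OF ab(2,3)] theta_closed ab by auto
  have xb: "x \<otimes> \<theta> b = \<theta> a"
    unfolding ab(4) using a b by (simp add: m_assoc)
  have "(\<eta> c \<otimes> x) \<otimes> \<theta> b = \<theta> a \<otimes> \<eta> c"
    using x b xb central[OF ab(1)] by (simp add: m_assoc)
  also have "\<dots> = (x \<otimes> \<eta> c) \<otimes> \<theta> b"
    using x b central[OF ab(2)] by (simp add: m_assoc flip: xb)
  finally have "(\<eta> c \<otimes> x) \<otimes> \<theta> b = (x \<otimes> \<eta> c) \<otimes> \<theta> b" .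
  then show ?thesis
    using x by (intro Units_r_cancel[OF b(1), of "\<eta> c \<otimes> x" "x \<otimes> \<eta> c"]) simp_all
qed

section \<open>Laurent monomials and their sums\<close>

abbreviation word :: "generator list \<Rightarrow> 'd" where
  "word u \<equiv> \<theta> (Poly_Mapping.single u 1)"

lemma word_closed: "u \<in> lists G \<Longrightarrow> word u \<in> carrier D"
  by (rule theta_closed) simp

lemma word_Nil: "word [] = \<one>"
  using eta_one by (simp add: \<eta>_def)

lemma word_append: "u \<in> lists G \<Longrightarrow> v \<in> lists G \<Longrightarrow> word (u @ v) = word u \<otimes> word v"
  using theta_mult[of "Poly_Mapping.single u 1" "Poly_Mapping.single v 1"]
  by (simp add: mult_single plus_list_def)

lemma word_Units: "u \<in> lists G \<Longrightarrow> word u \<in> Units D"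
  by (rule lead_Units[OF lead_single]) auto

lemma theta_single: "u \<in> lists G \<Longrightarrow> \<theta> (Poly_Mapping.single u c) = \<eta> c \<otimes> word u"
  using theta_mult[of "Poly_Mapping.single [] c" "Poly_Mapping.single u 1"]
  by (simp add: \<eta>_def mult_single plus_list_def)

lemma nrm_word: "u \<in> lists G \<Longrightarrow> nrm (word u) = real (wt u)"
  by (rule nrm_lead[OF lead_single]) auto

text \<open>
  For \<open>r = 0\<close> these are the scalar multiples of the Laurent monomials; the condition is stated
  without inverses so that words can be rearranged in it directly.
\<close>

definition Mon :: "'d set" where
  "Mon = {x \<in> Units D. \<exists>u\<in>lists G. \<exists>v\<in>lists G. \<exists>c. c \<noteq> 0 \<and> x \<otimes> word v = \<eta> c \<otimes> word u}"

lemma Mon_Units: "x \<in> Mon \<Longrightarrow> x \<in> Units D"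
  by (simp add: Mon_def)

lemma Mon_closed: "x \<in> Mon \<Longrightarrow> x \<in> carrier D"
  by (rule Units_closed[OF Mon_Units])

lemma MonE:
  assumes "x \<in> Mon"
  obtains u v c where "x \<in> Units D" "u \<in> lists G" "v \<in> lists G" "c \<noteq> 0" "x \<otimes> word v = \<eta> c \<otimes> word u"
proof -
  have "x \<in> Units D \<and> (\<exists>u\<in>lists G. \<exists>v\<in>lists G. \<exists>c. c \<noteq> 0 \<and> x \<otimes> word v = \<eta> c \<otimes> word u)"
    using assms unfolding Mon_def by (rule CollectD)
  then show thesis
    using that by (elim conjE bexE exE) (rule that)
qed

lemma MonI:
  assumes "x \<in> Units D" "u \<in> lists G" "v \<in> lists G" "c \<noteq> 0" "x \<otimes> word v = \<eta> c \<otimes> word u"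
  shows "x \<in> Mon"
  using assms unfolding Mon_def by blast

lemma theta_single_Mon: "u \<in> lists G \<Longrightarrow> c \<noteq> 0 \<Longrightarrow> \<theta> (Poly_Mapping.single u c) \<in> Mon"
  using lead_Units[OF lead_single, of u c] word_Nil
  by (intro MonI[of _ u "[]" c]) (simp_all add: theta_single[of u c] word_closed)

lemma eta_Mon: "c \<noteq> 0 \<Longrightarrow> \<eta> c \<in> Mon"
  unfolding \<eta>_def by (rule theta_single_Mon) auto

lemma Mon_inv:
  assumes "x \<in> Mon"
  shows "inv x \<in> Mon"
proof -
  obtain u v c where x: "x \<in> Units D" "u \<in> lists G" "v \<in> lists G" "c \<noteq> 0" "x \<otimes> word v = \<eta> c \<otimes> word u"
    using assms by (rule MonE)
  note closed = x(1) Units_closed[OF x(1)] word_closed[OF x(2)] word_closed[OF x(3)]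
  have "inv x \<otimes> (\<eta> c \<otimes> word u) = word v"
    unfolding x(5)[symmetric] using closed by (simp flip: m_assoc)
  moreover have "\<eta> (inverse c) \<otimes> (inv x \<otimes> (\<eta> c \<otimes> word u)) = (\<eta> (inverse c) \<otimes> \<eta> c) \<otimes> (inv x \<otimes> word u)"
    using closed eta_central[of "inv x" c] by (simp add: m_assoc) (simp flip: m_assoc)
  ultimately have "inv x \<otimes> word u = \<eta> (inverse c) \<otimes> word v"
    using x(4) closed by (simp flip: eta_mult)
  then show ?thesis
    using x by (intro MonI[of _ v u "inverse c"]) auto
qed

text \<open>\<open>P\<close> restricts the norms of the terms. For \<open>r = 0\<close>,
  \<open>UNIV\<close> gives all Laurent polynomials and \<open>- {1}\<close> those without constant
  term, because a monomial of norm 1 is then a scalar by \<open>Mon_eqI\<close>.\<close>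

inductive_set Tsum :: "real set \<Rightarrow> 'd set" for P where
  zero: "\<zero> \<in> Tsum P"
| add: "x \<in> Mon \<Longrightarrow> nrm x \<in> P \<Longrightarrow> y \<in> Tsum P \<Longrightarrow> x \<oplus> y \<in> Tsum P"

context
  assumes r0: "r = 0"
begin

lemma word_rearrange:
  assumes "mset u = mset v" "u \<in> lists G"
  obtains l where "l \<noteq> 0" "word u = \<eta> l \<otimes> word v"
proof -
  have v: "v \<in> lists G"
    using assms by (metis lists_eq_set mem_Collect_eq set_mset_mset)
  obtain l where l: "l \<in> L" "r = 0 \<Longrightarrow> Poly_Mapping.single u 1 - Poly_Mapping.single v l \<in> I"
    using rearrange[OF assms] by metis
  have "word u = \<theta> (Poly_Mapping.single v l)"
    using l(2)[OF r0] assms v by (subst theta_eq_iff) auto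
  then show thesis
    using that[of l] L_nz[OF l(1)] theta_single[OF v, of l] by simp
qed

text \<open>The denominator of \<open>x\<close> has to pass the numerator of \<open>y\<close>; for
  \<open>r = 0\<close> this reordering costs only a scalar.\<close>

lemma Mon_mult:
  assumes "x \<in> Mon" "y \<in> Mon"
  shows "x \<otimes> y \<in> Mon"
proof -
  obtain u v c where x: "x \<in> Units D" "u \<in> lists G" "v \<in> lists G" "c \<noteq> 0" "x \<otimes> word v = \<eta> c \<otimes> word u"
    using assms(1) by (rule MonE)
  obtain u' v' c' where y: "y \<in> Units D" "u' \<in> lists G" "v' \<in> lists G" "c' \<noteq> 0" "y \<otimes> word v' = \<eta> c' \<otimes> word u'"
    using assms(2) by (rule MonE)
  obtain l where l: "l \<noteq> 0" "word (u' @ v) = \<eta> l \<otimes> word (v @ u')"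
    using word_rearrange[of "u' @ v" "v @ u'"] x y by auto
  note closed = x(1) y(1) Units_closed[OF x(1)] Units_closed[OF y(1)] word_closed[OF x(2)] word_closed[OF x(3)] word_closed[OF y(2)] word_closed[OF y(3)]
  have "x \<otimes> y \<otimes> word (v' @ v) = x \<otimes> (y \<otimes> word v') \<otimes> word v"
    using closed x(3) y(3) by (simp add: word_append m_assoc)
  also have "\<dots> = (x \<otimes> \<eta> c') \<otimes> word (u' @ v)"
    using closed x(3) y(2) by (simp add: y(5) word_append m_assoc)
  also have "\<dots> = (x \<otimes> \<eta> (c' * l)) \<otimes> word (v @ u')"
    using closed x(3) y(2) by (simp add: l(2) eta_mult word_append m_assoc)
  also have "\<dots> = \<eta> (c' * l) \<otimes> (x \<otimes> word v) \<otimes> word u'"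
    using closed x(3) y(2) by (simp add: word_append m_assoc flip: eta_central)
  also have "\<dots> = \<eta> (c' * l * c) \<otimes> word (u @ u')"
    using closed x(2) y(2) by (simp add: x(5) eta_mult word_append m_assoc)
  finally have "x \<otimes> y \<otimes> word (v' @ v) = \<eta> (c' * l * c) \<otimes> word (u @ u')" .
  moreover have "v' @ v \<in> lists G" "u @ u' \<in> lists G" "c' * l * c \<noteq> 0"
    using x y l by auto
  ultimately show ?thesis
    using x(1) y(1) by (intro MonI[of _ "u @ u'" "v' @ v" "c' * l * c"]) auto
qed

text \<open>Cross-multiplying, equality of the norms says that \<open>u' @ v\<close> and
  \<open>u @ v'\<close> have the same weight. They are then rearrangements of each other, hence
  proportional.\<close>

lemma Mon_eqI:
  assumes "x \<in> Mon" "y \<in> Mon" "nrm x = nrm y"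
  obtains c where "c \<noteq> 0" "y = \<eta> c \<otimes> x"
proof -
  obtain u v c where x: "x \<in> Units D" "u \<in> lists G" "v \<in> lists G" "c \<noteq> 0" "x \<otimes> word v = \<eta> c \<otimes> word u"
    using assms(1) by (rule MonE)
  obtain u' v' c' where y: "y \<in> Units D" "u' \<in> lists G" "v' \<in> lists G" "c' \<noteq> 0" "y \<otimes> word v' = \<eta> c' \<otimes> word u'"
    using assms(2) by (rule MonE)
  note closed = x(1) y(1) Units_closed[OF x(1)] Units_closed[OF y(1)] word_closed[OF x(2)] word_closed[OF x(3)] word_closed[OF y(2)] word_closed[OF y(3)]
  have "nrm x * real (wt v) = real (wt u)" "nrm y * real (wt v') = real (wt u')"
    using nrm_mult[of x "word v"] nrm_mult[of y "word v'"] closed x y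
    by (simp_all add: nrm_mult nrm_word nrm_eta)
  then have "real (wt (u' @ v)) = real (wt (u @ v'))"
    using assms(3) by (auto simp: algebra_simps) (metis mult.assoc mult.commute)
  then have "mset (u' @ v) = mset (u @ v')"
    by (simp only: of_nat_eq_iff wt_eq_iff)
  then obtain l where l: "l \<noteq> 0" "word (u' @ v) = \<eta> l \<otimes> word (u @ v')"
    using word_rearrange[of "u' @ v" "u @ v'"] x y by auto
  obtain k where k: "k \<noteq> 0" "word (v @ v') = \<eta> k \<otimes> word (v' @ v)"
    using word_rearrange[of "v @ v'" "v' @ v"] x y by auto
  have 1: "y \<otimes> word (v' @ v) = \<eta> (c' * l) \<otimes> word (u @ v')"
  proof -
    have "y \<otimes> word (v' @ v) = (y \<otimes> word v') \<otimes> word v"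
      using closed x(3) y(3) by (simp add: word_append m_assoc)
    also have "\<dots> = \<eta> c' \<otimes> word (u' @ v)"
      unfolding y(5) using closed x(3) y(2) by (simp add: word_append m_assoc)
    also have "\<dots> = \<eta> (c' * l) \<otimes> word (u @ v')"
      unfolding l(2) using x(2) y(3) by (simp add: eta_mult m_assoc word_closed)
    finally show ?thesis .
  qed
  have 2: "\<eta> k \<otimes> x \<otimes> word (v' @ v) = \<eta> c \<otimes> word (u @ v')"
  proof -
    have "\<eta> k \<otimes> x \<otimes> word (v' @ v) = x \<otimes> (\<eta> k \<otimes> word (v' @ v))"
      using closed x(3) y(3) eta_central[of x k] by (simp add: word_closed m_assoc)
    also have "\<dots> = (x \<otimes> word v) \<otimes> word v'"
      unfolding k(2)[symmetric] using closed x(3) y(3) by (simp add: word_append m_assoc)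
    also have "\<dots> = \<eta> c \<otimes> word (u @ v')"
      unfolding x(5) using closed x(2) y(3) by (simp add: word_append m_assoc)
    finally show ?thesis .
  qed
  \<comment> \<open>Over the denominator \<open>word (v' @ v)\<close> the numerators of
    \<open>y\<close> and of \<open>k\<close> times \<open>x\<close> are the multiples
    \<open>c' * l\<close> and \<open>c\<close> of one word, whence the ratio
    \<open>?e * k\<close>.\<close>
  let ?e = "c' * l * inverse c"
  have "(\<eta> (?e * k) \<otimes> x) \<otimes> word (v' @ v) = \<eta> ?e \<otimes> (\<eta> k \<otimes> x \<otimes> word (v' @ v))"
    using closed x(3) y(3) by (simp add: eta_mult m_assoc word_closed)
  also have "\<dots> = y \<otimes> word (v' @ v)"
    unfolding 1 2 using x(2,4) y(3) word_closed[of "u @ v'"] by (simp add: mult.assoc flip: m_assoc eta_mult)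
  finally have "y = \<eta> (?e * k) \<otimes> x"
    using Units_r_cancel[OF word_Units[of "v' @ v"], of "\<eta> (?e * k) \<otimes> x" y] closed x(3) y(3)
    by (simp add: Units_closed)
  then show thesis
    using that[of "?e * k"] x(4) y(4) l(1) k(1) by simp
qed

lemma Mon_same_norm_add:
  assumes "x \<in> Mon" "y \<in> Mon" "nrm x = nrm y" "x \<oplus> y \<noteq> \<zero>"
  shows "x \<oplus> y \<in> Mon" "nrm (x \<oplus> y) = nrm x"
proof -
  obtain c where c: "c \<noteq> 0" "y = \<eta> c \<otimes> x"
    using Mon_eqI[OF assms(1-3)] .
  have x: "x \<in> carrier D"
    using assms(1) by (rule Mon_closed)
  have xy: "x \<oplus> y = \<eta> (1 + c) \<otimes> x"
    using x by (simp add: c(2) eta_add l_distr)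
  then have "1 + c \<noteq> 0"
    using assms(4) x by (metis eta_zero l_null)
  then show "x \<oplus> y \<in> Mon" "nrm (x \<oplus> y) = nrm x"
    unfolding xy using x by (auto intro: Mon_mult eta_Mon assms simp: nrm_mult nrm_eta)
qed

text \<open>Collecting the terms of equal norm turns a sum of monomials into one with distinct norms.\<close>

lemma Tsum_finsum:
  assumes "x \<in> Tsum P"
  shows "\<exists>X f. finite X \<and> X \<subseteq> P \<and> (\<forall>t. f t = \<zero> \<or> f t \<in> Mon \<and> nrm (f t) = t) \<and> x = finsum D f X"
  using assms
proof induction
  case zero
  show ?case
    by (intro exI[of _ "{}"] exI[of _ "\<lambda>_. \<zero>"]) simp
next
  case (add m y)
  then obtain X f where X: "finite X" "X \<subseteq> P" and f: "\<And>t. f t = \<zero> \<or> f t \<in> Mon \<and> nrm (f t) = t"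
    and y: "y = finsum D f X"
    by blast
  \<comment> \<open>Outside \<open>X\<close> the value of \<open>f\<close> does not occur in the sum
    and may be arbitrary, so it is overwritten there instead of added to. Inside, the two terms may
    cancel, which is why zero values are allowed.\<close>
  define g where "g = f(nrm m := (if nrm m \<in> X then m \<oplus> f (nrm m) else m))"
  have fc: "f t \<in> carrier D" for t
    using f[of t] Mon_closed by auto
  have m: "m \<in> carrier D"
    using add.hyps(1) by (rule Mon_closed)
  have gc: "g t \<in> carrier D" for t
    using fc m by (simp add: g_def)
  have g: "g t = \<zero> \<or> g t \<in> Mon \<and> nrm (g t) = t" for t
  proof (cases "t = nrm m")
    case True
    show ?thesis
    proof (cases "nrm m \<in> X \<and> f t \<noteq> \<zero>")
      case X: True
      then have "f t \<in> Mon" "nrm m = nrm (f t)" "g t = m \<oplus> f t"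
        using f[of t] True by (simp_all add: g_def)
      then show ?thesis
        using Mon_same_norm_add[OF add.hyps(1)] True by metis
    next
      case False
      then have "g t = m"
        using True m by (auto simp: g_def)
      then show ?thesis
        using True add.hyps(1) by simp
    qed
  next
    case False
    then show ?thesis
      using f by (simp add: g_def)
  qed
  have fin: "finite (X - {nrm m})"
    using X(1) by simp
  have eq: "finsum D g (insert (nrm m) (X - {nrm m})) = g (nrm m) \<oplus> finsum D f (X - {nrm m})"
  proof -
    have "finsum D g (X - {nrm m}) = finsum D f (X - {nrm m})"
      using fc by (intro finsum_cong') (auto simp: g_def)
    then show ?thesis
      using fin gc by (subst finsum_insert) auto
  qed
  have "m \<oplus> y = finsum D g (insert (nrm m) X)"
  proof (cases "nrm m \<in> X")
    case True
    have "finsum D f (insert (nrm m) (X - {nrm m})) = f (nrm m) \<oplus> finsum D f (X - {nrm m})"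
      using fin fc by (subst finsum_insert) auto
    moreover have "insert (nrm m) (X - {nrm m}) = X" "insert (nrm m) X = X"
      using True by auto
    moreover have "finsum D f (X - {nrm m}) \<in> carrier D"
      using fc by (intro finsum_closed) auto
    ultimately show ?thesis
      using eq True m fc by (simp add: y g_def a_assoc)
  next
    case False
    then show ?thesis
      using eq by (simp add: y g_def)
  qed
  then show ?case
    using X add.hyps(2) g by (intro exI[of _ "insert (nrm m) X"] exI[of _ g]) auto
qed

text \<open>Nonzero terms have pairwise different norms, so by the isosceles principle none cancels
  and the norm of the sum is that of its largest term.\<close>

lemma nrm_finsum:
  assumes "finite X" "\<And>t. f t = \<zero> \<or> f t \<in> Mon \<and> nrm (f t) = t"
  shows "nrm (finsum D f X) \<in> insert 0 X"
  using assms(1)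
proof induction
  case (insert t X)
  have fc: "f t \<in> carrier D" for t
    using assms(2)[of t] Mon_closed by auto
  then have S: "finsum D f X \<in> carrier D"
    by (intro finsum_closed) auto
  have "finsum D f (insert t X) = f t \<oplus> finsum D f X"
    using insert.hyps fc by (intro finsum_insert) auto
  moreover have "nrm (f t \<oplus> finsum D f X) \<in> insert 0 (insert t X)"
  proof (cases "f t = \<zero>")
    case False
    then have t: "nrm (f t) = t"
      using assms(2)[of t] by auto
    \<comment> \<open>The rest of the sum may have norm 0, from which \<open>t\<close> must be told
      apart too.\<close>
    have "t \<noteq> 0"
      using False t nrm_eq_zero[OF fc[of t]] by auto
    then have "nrm (f t) \<noteq> nrm (finsum D f X)"
      using insert t by auto
    then show ?thesis
      using nrm_add_eq_max[OF fc[of t] S] insert.IH t by (auto simp: max_def)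
  qed (use S insert.IH in auto)
  ultimately show ?case
    by simp
qed simp

text \<open>The norm of \<open>x\<close> is 0 or that of one of its terms, hence different from 1,
  so \<open>x\<close> cannot cancel a constant.\<close>

lemma nrm_eta_diff_Tsum:
  assumes "x \<in> Tsum (- {1})" "c \<noteq> 0"
  shows "nrm (\<eta> c \<ominus> x) \<ge> 1"
proof -
  obtain X f where X: "finite X" "X \<subseteq> - {1}" "\<And>t. f t = \<zero> \<or> f t \<in> Mon \<and> nrm (f t) = t" "x = finsum D f X"
    using Tsum_finsum[OF assms(1)] by blast
  have x: "x \<in> carrier D"
    unfolding X(4) using X(3) Mon_closed by (intro finsum_closed) (auto, metis zero_closed)
  have "nrm (\<ominus> x) \<noteq> nrm (\<eta> c)"
    using nrm_finsum[OF X(1,3)] X(2) assms(2) x by (auto simp: nrm_uminus nrm_eta X(4)[symmetric])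
  then have "nrm (\<eta> c \<ominus> x) = max 1 (nrm (\<ominus> x))"
    using nrm_add_eq_max[of "\<eta> c" "\<ominus> x"] x assms(2) by (simp add: minus_eq nrm_eta)
  then show ?thesis
    by simp
qed

section \<open>Density of the Laurent polynomials\<close>

lemma Tsum_closed: "x \<in> Tsum P \<Longrightarrow> x \<in> carrier D"
  by (induction rule: Tsum.induct) (auto dest: Mon_closed)

lemma Tsum_add: "x \<in> Tsum P \<Longrightarrow> y \<in> Tsum P \<Longrightarrow> x \<oplus> y \<in> Tsum P"
  by (induction rule: Tsum.induct) (auto simp: Tsum_closed Mon_closed a_assoc intro: Tsum.add)

lemma Tsum_Mon: "x \<in> Mon \<Longrightarrow> nrm x \<in> P \<Longrightarrow> x \<in> Tsum P"
  using Tsum.add[OF _ _ Tsum.zero, of x P] Mon_closed[of x] by simp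

lemma Tsum_mult:
  assumes "x \<in> Tsum UNIV" "y \<in> Tsum UNIV"
  shows "x \<otimes> y \<in> Tsum UNIV"
proof -
  have *: "m \<otimes> y \<in> Tsum UNIV" if m: "m \<in> Mon" for m
    using assms(2)
  proof (induction rule: Tsum.induct)
    case (add z y)
    then have "m \<otimes> z \<oplus> m \<otimes> y \<in> Tsum UNIV"
      using m by (intro Tsum.add Mon_mult) simp_all
    then show ?case
      using m add.hyps by (simp add: Mon_closed Tsum_closed r_distr)
  qed (use m in \<open>simp add: Mon_closed Tsum.zero\<close>)
  show ?thesis
    using assms(1)
  proof (induction rule: Tsum.induct)
    case (add z x)
    then have "z \<otimes> y \<oplus> x \<otimes> y \<in> Tsum UNIV"
      using * by (intro Tsum_add)
    then show ?case
      using assms(2) add.hyps by (simp add: Mon_closed Tsum_closed l_distr)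
  qed (use assms(2) in \<open>simp add: Tsum_closed Tsum.zero\<close>)
qed

lemma Tsum_uminus:
  assumes "x \<in> Tsum UNIV"
  shows "\<ominus> x \<in> Tsum UNIV"
  using Tsum_mult[OF Tsum_Mon[OF eta_Mon[of "- 1"]] assms] by (simp add: uminus_eta Tsum_closed[OF assms])

lemma theta_Tsum:
  assumes "Poly_Mapping.keys p \<subseteq> lists G"
  shows "\<theta> p \<in> Tsum UNIV"
proof -
  let ?s = "\<lambda>K. \<Sum>u\<in>K. Poly_Mapping.single u (Poly_Mapping.lookup p u)"
  have "\<theta> (?s K) \<in> Tsum UNIV \<and> Poly_Mapping.keys (?s K) \<subseteq> lists G"
    if "finite K" "K \<subseteq> Poly_Mapping.keys p" for K
    using that
  proof (induction K)
    case empty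
    then show ?case by (simp add: theta_zero Tsum.zero)
  next
    case (insert u K)
    have u: "u \<in> lists G" "Poly_Mapping.lookup p u \<noteq> 0"
      using insert.prems assms by (auto simp: in_keys_iff)
    have keys: "Poly_Mapping.keys (Poly_Mapping.single u (Poly_Mapping.lookup p u)) \<subseteq> lists G"
      using u(1) by (rule keys_single_lists)
    have IH: "\<theta> (?s K) \<in> Tsum UNIV" "Poly_Mapping.keys (?s K) \<subseteq> lists G"
      using insert by auto
    show ?case
      using insert.hyps theta_add[OF keys IH(2)] free_algebra_add_closed[OF keys IH(2)]
        Tsum.add[OF theta_single_Mon[OF u] _ IH(1)] by simp
  qed
  from this[of "Poly_Mapping.keys p"] show ?thesis
    using poly_mapping_sum_single[of p] by simp
qed

text \<open>A geometric series: dividing \<open>b\<close> by its leading monomial \<open>m\<close>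
  leaves 1 up to an error of norm \<open>q < 1\<close>, and the partial sums approximate the inverse
  of \<open>b\<close> from within the Laurent polynomials.\<close>

lemma inverse_approx:
  assumes b: "Poly_Mapping.keys b \<subseteq> lists G" "b \<notin> I"
  obtains q where "0 \<le> q" "q < 1" "\<And>k. \<exists>t\<in>Tsum UNIV. nrm (\<one> \<ominus> \<theta> b \<otimes> t) \<le> q ^ k"
proof -
  obtain c u where u: "lead b c u"
    using lead_exists[OF b] .
  define m where "m = \<theta> (Poly_Mapping.single u c)"
  have mM: "m \<in> Mon"
    unfolding m_def using u by (intro theta_single_Mon) (auto simp: lead_def)
  have nm: "nrm m = real (wt u)"
    unfolding m_def using u by (intro nrm_lead[OF lead_single]) (auto simp: lead_def)
  define e where "e = \<theta> (b - Poly_Mapping.single u c)"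
  have keys: "Poly_Mapping.keys (Poly_Mapping.single u c) \<subseteq> lists G" "Poly_Mapping.keys (b - Poly_Mapping.single u c) \<subseteq> lists G"
    using u spn_carrier[OF _ below_lists] by (auto simp: lead_def)
  have ec: "e \<in> carrier D"
    unfolding e_def using keys by (intro theta_closed)
  have mD: "m \<in> Units D" "m \<in> carrier D" "inv m \<in> carrier D"
    using mM Mon_Units Mon_closed Mon_inv by auto
  have bme: "\<theta> b = m \<oplus> e"
    using theta_add[OF keys] by (simp add: m_def e_def)
  have bc: "\<theta> b \<in> carrier D"
    using b by (intro theta_closed)
  have ne: "nrm e < nrm m"
  proof (cases "b - Poly_Mapping.single u c \<in> I")
    case True
    then show ?thesis
      using theta_eq_zero[OF keys(2)] nm by (simp add: e_def)
  next
    case False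
    then obtain d v where "lead (b - Poly_Mapping.single u c) d v" "wt v < wt u"
      using lead_exists_below[of "b - Poly_Mapping.single u c" "wt u"] u by (auto simp: lead_def)
    then show ?thesis
      by (simp add: e_def nm nrm_lead)
  qed
  define q where "q = nrm (\<one> \<ominus> \<theta> b \<otimes> inv m)"
  have "\<one> \<ominus> \<theta> b \<otimes> inv m = \<ominus> (e \<otimes> inv m)"
    unfolding bme using mD ec by (simp add: l_distr minus_eq minus_add r_neg flip: a_assoc)
  then have "q = nrm e * nrm (inv m)"
    unfolding q_def using ec mD by (simp add: nrm_uminus nrm_mult)
  moreover have "nrm m * nrm (inv m) = 1"
    using nrm_mult[OF mD(2,3)] mD by simp
  moreover have "nrm (inv m) > 0"
    using \<open>nrm m * nrm (inv m) = 1\<close> nrm_nonneg[OF mD(3)] by (cases "nrm (inv m) = 0") auto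
  ultimately have "q < 1"
    using mult_strict_right_mono[OF ne, of "nrm (inv m)"] by simp
  have q0: "0 \<le> q"
    unfolding q_def using bc mD by (intro nrm_nonneg) simp
  have "\<exists>t\<in>Tsum UNIV. nrm (\<one> \<ominus> \<theta> b \<otimes> t) \<le> q ^ k" for k
  proof (induction k)
    case 0
    show ?case
      using bc by (intro bexI[of _ \<zero>]) (auto simp: Tsum.zero minus_eq)
  next
    case (Suc k)
    then obtain t where t: "t \<in> Tsum UNIV" "nrm (\<one> \<ominus> \<theta> b \<otimes> t) \<le> q ^ k"
      by blast
    have tc: "t \<in> carrier D"
      using t(1) by (rule Tsum_closed)
    \<comment> \<open>This correction multiplies the error
      \<open>\<one> \<ominus> \<theta> b \<otimes> t\<close> from the left by
      \<open>\<one> \<ominus> \<theta> b \<otimes> inv m\<close>, so its norm shrinks by the factor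
      \<open>q\<close>.\<close>
    define s where "s = t \<oplus> inv m \<otimes> (\<one> \<ominus> \<theta> b \<otimes> t)"
    have invm: "inv m \<in> Tsum UNIV" and one: "\<one> \<in> Tsum UNIV"
      using Mon_inv[OF mM] eta_Mon[of 1] by (auto intro: Tsum_Mon)
    have s: "s \<in> Tsum UNIV"
      unfolding s_def minus_eq
      using t(1) theta_Tsum[OF b(1)] invm one by (intro Tsum_add Tsum_mult Tsum_uminus)
    have "\<one> \<ominus> \<theta> b \<otimes> s = (\<one> \<ominus> \<theta> b \<otimes> inv m) \<otimes> (\<one> \<ominus> \<theta> b \<otimes> t)"
      unfolding s_def using bc mD tc
      by (simp add: minus_eq l_distr r_distr minus_add l_minus r_minus m_assoc a_ac)
    then have "nrm (\<one> \<ominus> \<theta> b \<otimes> s) = q * nrm (\<one> \<ominus> \<theta> b \<otimes> t)"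
      unfolding q_def using bc mD tc by (simp add: nrm_mult)
    then show ?case
      using s t(2) q0 by (intro bexI[of _ s]) (auto intro: mult_left_mono)
  qed
  then show thesis
    using that q0 \<open>q < 1\<close> by blast
qed

text \<open>Replacing the inverse of the denominator by an approximation \<open>t\<close> changes
  \<open>x\<close> by \<open>x \<otimes> (\<one> \<ominus> \<theta> b \<otimes> t)\<close>, which is
  as small as desired.\<close>

lemma Tsum_dense:
  assumes x: "x \<in> carrier D" and "0 < e"
  obtains t where "t \<in> Tsum UNIV" "nrm (x \<ominus> t) < e"
proof -
  obtain a b where ab: "Poly_Mapping.keys a \<subseteq> lists G" "Poly_Mapping.keys b \<subseteq> lists G" "b \<notin> I" "x = \<theta> a \<otimes> inv \<theta> b"
    using fraction[OF x(1)] by blast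
  have a: "\<theta> a \<in> carrier D" and b: "\<theta> b \<in> Units D" "\<theta> b \<in> carrier D"
    using theta_Units[OF ab(2,3)] theta_closed ab by auto
  obtain q where q: "0 \<le> q" "q < 1" "\<And>k. \<exists>t\<in>Tsum UNIV. nrm (\<one> \<ominus> \<theta> b \<otimes> t) \<le> q ^ k"
    using inverse_approx[OF ab(2,3)] by blast
  have "(\<lambda>k. nrm x * q ^ k) \<longlonglongrightarrow> nrm x * 0"
    using q by (intro tendsto_mult_left LIMSEQ_realpow_zero)
  then have "eventually (\<lambda>k. nrm x * q ^ k < e) sequentially"
    by (rule order_tendstoD(2)) (simp add: \<open>0 < e\<close>)
  then obtain k where k: "nrm x * q ^ k < e"
    by (auto simp: eventually_sequentially)
  obtain t where t: "t \<in> Tsum UNIV" "nrm (\<one> \<ominus> \<theta> b \<otimes> t) \<le> q ^ k"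
    using q(3) by blast
  have tc: "t \<in> carrier D"
    using t(1) by (rule Tsum_closed)
  have "inv \<theta> b \<otimes> (\<theta> b \<otimes> t) = t"
    using b tc by (simp flip: m_assoc)
  then have "x \<ominus> \<theta> a \<otimes> t = x \<otimes> (\<one> \<ominus> \<theta> b \<otimes> t)"
    using a b tc by (simp add: ab(4) minus_eq r_distr r_minus m_assoc)
  then have "nrm (x \<ominus> \<theta> a \<otimes> t) = nrm x * nrm (\<one> \<ominus> \<theta> b \<otimes> t)"
    using x b tc by (simp add: nrm_mult)
  also have "\<dots> \<le> nrm x * q ^ k"
    using t(2) nrm_nonneg[OF x] by (rule mult_left_mono)
  finally show thesis
    using that[of "\<theta> a \<otimes> t"] k Tsum_mult[OF theta_Tsum[OF ab(1)] t(1)] by simp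
qed

end

section \<open>Commutators have no constant term\<close>

definition comm :: "'d \<Rightarrow> 'd \<Rightarrow> 'd" where
  "comm x y = x \<otimes> y \<ominus> y \<otimes> x"

lemma comm_closed: "x \<in> carrier D \<Longrightarrow> y \<in> carrier D \<Longrightarrow> comm x y \<in> carrier D"
  by (simp add: comm_def)

lemma comm_add_left:
  "x \<in> carrier D \<Longrightarrow> y \<in> carrier D \<Longrightarrow> z \<in> carrier D \<Longrightarrow> comm (x \<oplus> y) z = comm x z \<oplus> comm y z"
  by (simp add: comm_def minus_eq l_distr r_distr minus_add a_ac)

lemma comm_add_right:
  "x \<in> carrier D \<Longrightarrow> y \<in> carrier D \<Longrightarrow> z \<in> carrier D \<Longrightarrow> comm x (y \<oplus> z) = comm x y \<oplus> comm x z"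
  by (simp add: comm_def minus_eq l_distr r_distr minus_add a_ac)

lemma comm_zero: "x \<in> carrier D \<Longrightarrow> comm \<zero> x = \<zero>" "x \<in> carrier D \<Longrightarrow> comm x \<zero> = \<zero>"
  by (simp_all add: comm_def minus_eq)

lemma nrm_comm_le:
  assumes "x \<in> carrier D" "y \<in> carrier D"
  shows "nrm (comm x y) \<le> nrm x * nrm y"
  using nrm_diff[of "x \<otimes> y" "y \<otimes> x"] assms by (simp add: comm_def nrm_mult mult.commute)

context
  assumes r0: "r = 0"
begin

text \<open>If the product has norm 1 it is a scalar, hence central; conjugating it by
  \<open>x\<close> gives \<open>y \<otimes> x\<close>, so the commutator vanishes. Otherwise both
  terms of the commutator have norm different from 1.\<close>

lemma comm_Mon:
  assumes "x \<in> Mon" "y \<in> Mon"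
  shows "comm x y \<in> Tsum (- {1})"
proof -
  have xy: "x \<in> carrier D" "y \<in> carrier D" "x \<in> Units D"
    using assms Mon_closed Mon_Units by auto
  show ?thesis
  proof (cases "nrm x * nrm y = 1")
    case True
    then have "nrm \<one> = nrm (x \<otimes> y)"
      using xy by (simp add: nrm_mult)
    then obtain c where c: "x \<otimes> y = \<eta> c"
      using Mon_eqI[OF r0, of \<one> "x \<otimes> y"] eta_Mon[of 1] Mon_mult[OF r0 assms] by auto
    have "inv x \<otimes> (x \<otimes> y) = y"
      using xy by (simp flip: m_assoc)
    then have "y \<otimes> x = inv x \<otimes> \<eta> c \<otimes> x"
      by (simp add: c)
    also have "\<dots> = \<eta> c"
      using xy by (simp add: m_assoc flip: eta_central)
  finally show ?thesis
      by (simp add: comm_def c r_neg minus_eq Tsum.zero)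
  next
    case False
    have "comm x y = x \<otimes> y \<oplus> (\<eta> (- 1) \<otimes> (y \<otimes> x))"
      using xy by (simp add: comm_def minus_eq uminus_eta)
    moreover have "\<eta> (- 1) \<otimes> (y \<otimes> x) \<in> Mon"
      using assms by (intro Mon_mult[OF r0] eta_Mon) auto
    moreover have "nrm (x \<otimes> y) \<in> - {1}" "nrm (\<eta> (- 1) \<otimes> (y \<otimes> x)) \<in> - {1}"
      using False xy by (simp_all add: nrm_mult nrm_eta mult.commute)
    ultimately show ?thesis
      using Tsum_add[OF r0 Tsum_Mon[OF r0 Mon_mult[OF r0 assms]] Tsum_Mon[OF r0]] by metis
  qed
qed

lemma comm_Tsum:
  assumes "x \<in> Tsum UNIV" "y \<in> Tsum UNIV"
  shows "comm x y \<in> Tsum (- {1})"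
proof -
  note [simp] = Mon_closed Tsum_closed[OF r0]
  have *: "comm m y \<in> Tsum (- {1})" if m: "m \<in> Mon" for m
    using assms(2)
  proof (induction rule: Tsum.induct)
    case (add z y)
    then show ?case
      using m by (simp add: comm_add_right comm_Mon Tsum_add[OF r0])
  qed (use m in \<open>simp add: comm_zero Tsum.zero\<close>)
  show ?thesis
    using assms(1)
  proof (induction rule: Tsum.induct)
    case (add z x)
    then show ?case
      using assms(2) * by (simp add: comm_add_left Tsum_add[OF r0])
  qed (use assms(2) in \<open>simp add: comm_zero Tsum.zero\<close>)
qed

lemma comm_near_Tsum:
  assumes x: "x \<in> carrier D" and y: "y \<in> carrier D"
  shows "\<exists>t\<in>Tsum (- {1}). nrm (comm x y \<ominus> t) < 1"
proof -
  have y1: "nrm y + 1 > 0"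
    using nrm_nonneg[OF y] by simp
  \<comment> \<open>The tolerances make both error commutators below smaller than 1; adding 1 keeps
    the denominators positive. The approximation of \<open>y\<close> comes second because its
    tolerance depends on \<open>s\<close>.\<close>
  obtain s where s: "s \<in> Tsum UNIV" "nrm (x \<ominus> s) < 1 / (nrm y + 1)"
    using Tsum_dense[OF r0 x, of "1 / (nrm y + 1)"] y1 by auto
  have sc: "s \<in> carrier D"
    using s(1) by (rule Tsum_closed[OF r0])
  have s1: "nrm s + 1 > 0"
    using nrm_nonneg[OF sc] by simp
  obtain t where t: "t \<in> Tsum UNIV" "nrm (y \<ominus> t) < 1 / (nrm s + 1)"
    using Tsum_dense[OF r0 y, of "1 / (nrm s + 1)"] s1 by auto
  have tc: "t \<in> carrier D"
    using t(1) by (rule Tsum_closed[OF r0])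
  \<comment> \<open>The product rule for errors: \<open>x\<close> is replaced by \<open>s\<close>
    first, then \<open>y\<close> by \<open>t\<close>.\<close>
  have split: "comm s t \<oplus> (comm (x \<ominus> s) y \<oplus> comm s (y \<ominus> t)) = comm x y"
  proof -
    have "comm s t \<oplus> comm s (y \<ominus> t) = comm s y"
    proof -
      have "t \<oplus> (y \<ominus> t) = y"
        using tc y by (simp add: minus_eq a_lcomm[of t y] r_neg)
      then show ?thesis
        using comm_add_right[of s t "y \<ominus> t"] sc tc y by simp
    qed
    moreover have "comm (x \<ominus> s) y \<oplus> comm s y = comm x y"
    proof -
      have "(x \<ominus> s) \<oplus> s = x"
        using sc x by (simp add: minus_eq a_assoc l_neg)
      then show ?thesis
        using comm_add_left[of "x \<ominus> s" s y] sc x y by simp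
    qed
    moreover have "comm s t \<oplus> (comm (x \<ominus> s) y \<oplus> comm s (y \<ominus> t)) = comm (x \<ominus> s) y \<oplus> (comm s t \<oplus> comm s (y \<ominus> t))"
      using sc tc x y by (intro a_lcomm comm_closed) simp_all
    ultimately show ?thesis
      by simp
  qed
  then have "comm x y \<ominus> comm s t = comm (x \<ominus> s) y \<oplus> comm s (y \<ominus> t)"
    using add_diff_cancel[of "comm s t" "comm (x \<ominus> s) y \<oplus> comm s (y \<ominus> t)"] sc tc x y by (simp add: comm_closed)
  moreover have "nrm (comm (x \<ominus> s) y) < 1"
  proof -
    have "nrm (comm (x \<ominus> s) y) \<le> nrm (x \<ominus> s) * nrm y"
      using sc x y by (intro nrm_comm_le) auto
    also have "\<dots> \<le> nrm (x \<ominus> s) * (nrm y + 1)"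
      using nrm_nonneg[of "x \<ominus> s"] sc x by (intro mult_left_mono) auto
    also have "\<dots> < 1"
      using s(2) y1 by (simp add: field_simps)
    finally show ?thesis .
  qed
  moreover have "nrm (comm s (y \<ominus> t)) < 1"
  proof -
    have "nrm (comm s (y \<ominus> t)) \<le> nrm s * nrm (y \<ominus> t)"
      using sc tc y by (intro nrm_comm_le) auto
    also have "\<dots> \<le> (nrm s + 1) * nrm (y \<ominus> t)"
      using nrm_nonneg[of "y \<ominus> t"] tc y by (intro mult_right_mono) auto
    also have "\<dots> < 1"
      using t(2) s1 by (simp add: field_simps)
    finally show ?thesis .
  qed
  ultimately have "nrm (comm x y \<ominus> comm s t) < 1"
    using nrm_add[of "comm (x \<ominus> s) y" "comm s (y \<ominus> t)"] sc tc x y by (simp add: comm_closed)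
  then show ?thesis
    using comm_Tsum[OF s(1) t(1)] by blast
qed

text \<open>Scalars are central and can be absorbed into a commutator, so the linear span is
  additively generated by commutators. Sums keep the bound 1 because the norm is
  ultrametric.\<close>

lemma lie_derived_near_Tsum:
  assumes "x \<in> lie_derived D \<eta>"
  shows "x \<in> carrier D \<and> (\<exists>t\<in>Tsum (- {1}). nrm (x \<ominus> t) < 1)"
proof -
  have gen: "\<eta> c \<otimes> (a \<otimes> b \<ominus> b \<otimes> a) = comm (\<eta> c \<otimes> a) b" if "a \<in> carrier D" "b \<in> carrier D" for c a b
  proof -
    have "b \<otimes> (\<eta> c \<otimes> a) = \<eta> c \<otimes> (b \<otimes> a)"
      using that eta_central[of b c] by (simp flip: m_assoc)
    then show ?thesis
      using that by (simp add: comm_def minus_eq r_distr r_minus m_assoc)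
  qed
  show ?thesis
    using assms unfolding lie_derived_def
  proof (induction rule: generate.induct)
    case one
    show ?case
      by (auto intro!: bexI[of _ \<zero>] simp: Tsum.zero minus_eq)
  next
    case (incl h)
    then obtain c a b where *: "a \<in> carrier D" "b \<in> carrier D" "h = comm (\<eta> c \<otimes> a) b"
      using gen by auto
    then show ?case
      using comm_near_Tsum[of "\<eta> c \<otimes> a" b] by (simp add: comm_closed)
  next
    case (inv h)
    then obtain c a b where *: "a \<in> carrier D" "b \<in> carrier D" "h = \<eta> c \<otimes> (a \<otimes> b \<ominus> b \<otimes> a)"
      by auto
    have "\<ominus> h = \<eta> (- 1 * c) \<otimes> (a \<otimes> b \<ominus> b \<otimes> a)"
      using * by (simp only: eta_mult) (simp add: uminus_eta m_assoc)
    then have "\<ominus> h = comm (\<eta> (- 1 * c) \<otimes> a) b"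
      using gen * by simp
    then show ?case
      using comm_near_Tsum[of "\<eta> (- 1 * c) \<otimes> a" b] * by (simp add: comm_closed flip: a_inv_def)
  next
    case (eng x y)
    then obtain s t where st: "s \<in> Tsum (- {1})" "nrm (x \<ominus> s) < 1" "t \<in> Tsum (- {1})" "nrm (y \<ominus> t) < 1"
      by blast
    have closed: "x \<in> carrier D" "y \<in> carrier D" "s \<in> carrier D" "t \<in> carrier D"
      using eng.IH st Tsum_closed[OF r0] by auto
    have "x \<oplus> y \<ominus> (s \<oplus> t) = (x \<ominus> s) \<oplus> (y \<ominus> t)"
      using closed by (simp add: minus_eq minus_add a_ac)
    then have "nrm (x \<oplus> y \<ominus> (s \<oplus> t)) < 1"
      using nrm_add[of "x \<ominus> s" "y \<ominus> t"] closed st by simp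
    then show ?case
      using closed Tsum_add[OF r0 st(1,3)] by auto
  qed
qed

lemma E_trace_eq_zero: "E_trace D \<eta> = {0}"
proof -
  have "c = 0" if c: "\<eta> c \<in> lie_derived D \<eta>" for c
  proof (rule ccontr)
    assume "c \<noteq> 0"
    obtain t where "t \<in> Tsum (- {1})" "nrm (\<eta> c \<ominus> t) < 1"
      using lie_derived_near_Tsum[OF c] by blast
    then show False
      using nrm_eta_diff_Tsum[OF r0 _ \<open>c \<noteq> 0\<close>] by fastforce
  qed
  moreover have "\<eta> 0 \<in> lie_derived D \<eta>"
    unfolding lie_derived_def using generate.one[of "add_monoid D"] by simp
  ultimately show ?thesis
    by (auto simp: E_trace_def)
qed

end

end

section \<open>Transfer to an arbitrary skew field of fractions\<close>

theorem proposition3p4p2: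
  fixes n r :: nat
    and \<Lambda> :: "nat \<Rightarrow> nat \<Rightarrow> 'k::field_char_0"
    and D :: "('d, 'm) ring_scheme"
    and \<iota> :: "(generator list \<Rightarrow>\<^sub>0 'k) set \<Rightarrow> 'd"
  assumes "n \<ge> 1" and "r \<le> n"
    and "mult_antisymmetric n \<Lambda>"
    and "skew_field_of_fractions (S_alg n r \<Lambda>) D \<iota>"
  shows "G_trace D (\<iota> \<circ> S_scalar n r \<Lambda>)
           = generate (units_of (univ_ring :: 'k ring)) {\<Lambda> i j | i j. i \<in> {1..n} \<and> j \<in> {1..n}}
       \<and> (r \<ge> 1 \<longrightarrow> E_trace D (\<iota> \<circ> S_scalar n r \<Lambda>) = UNIV)
       \<and> (r = 0 \<longrightarrow> E_trace D (\<iota> \<circ> S_scalar n r \<Lambda>) = {0})"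
proof -
  let ?A = "free_algebra (S_gens n r) :: (generator list \<Rightarrow>\<^sub>0 'k) ring"
  let ?I = "S_ideal n r \<Lambda>"
  \<comment> \<open>The quotient map followed by \<open>\<iota>\<close>; as \<open>\<iota>\<close>
    is injective, its kernel is \<open>?I\<close>.\<close>
  define \<theta> where "\<theta> p = \<iota> (?I +>\<^bsub>?A\<^esub> p)" for p
  have frac: "skew_field D" "\<iota> \<in> ring_hom (S_alg n r \<Lambda>) D" "inj_on \<iota> (carrier (S_alg n r \<Lambda>))"
    "\<And>d. d \<in> carrier D \<Longrightarrow> \<exists>a\<in>carrier (S_alg n r \<Lambda>). \<exists>b\<in>carrier (S_alg n r \<Lambda>) - {\<zero>\<^bsub>S_alg n r \<Lambda>\<^esub>}. d = \<iota> a \<otimes>\<^bsub>D\<^esub> inv\<^bsub>D\<^esub> (\<iota> b)"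
    using assms(4) by (auto simp: skew_field_of_fractions_def)
  interpret I: ideal ?I ?A
    by (rule ideal_S_ideal[OF assms(2)])
  interpret S: ring "S_alg n r \<Lambda>"
    by (rule ring_S_alg[OF assms(2)])
  interpret D: ring D
    using frac(1) by (simp add: skew_field_def)
  have carrier_A: "p \<in> carrier ?A \<longleftrightarrow> Poly_Mapping.keys p \<subseteq> lists (S_gens n r)" for p
    by (simp add: free_algebra_def)
  have coset_closed: "?I +>\<^bsub>?A\<^esub> p \<in> carrier (S_alg n r \<Lambda>)" if "p \<in> carrier ?A" for p
    using ring_hom_memE(1)[OF I.rcos_ring_hom that] by (simp add: S_alg_def)
  have coset_cases: "\<exists>p\<in>carrier ?A. a = ?I +>\<^bsub>?A\<^esub> p" if "a \<in> carrier (S_alg n r \<Lambda>)" for a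
    using that by (auto simp: S_alg_def FactRing_def A_RCOSETS_def')
  have coset_zero: "?I +>\<^bsub>?A\<^esub> p = \<zero>\<^bsub>S_alg n r \<Lambda>\<^esub> \<longleftrightarrow> p \<in> ?I" if "p \<in> carrier ?A" for p
    using I.a_rcos_const I.a_rcos_self[OF that] by (auto simp: S_alg_def FactRing_def)
  have hom: "\<theta> \<in> ring_hom ?A D"
    using ring_hom_trans[OF I.rcos_ring_hom frac(2)[unfolded S_alg_def]] by (simp add: \<theta>_def[abs_def] comp_def)
  have zero: "\<theta> p = \<zero>\<^bsub>D\<^esub> \<longleftrightarrow> p \<in> ?I" if "p \<in> carrier ?A" for p
  proof -
    have "\<iota> \<zero>\<^bsub>S_alg n r \<Lambda>\<^esub> = \<zero>\<^bsub>D\<^esub>"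
      by (rule ring_hom_zero[OF frac(2) S.ring_axioms D.ring_axioms])
    then have "\<theta> p = \<zero>\<^bsub>D\<^esub> \<longleftrightarrow> ?I +>\<^bsub>?A\<^esub> p = \<zero>\<^bsub>S_alg n r \<Lambda>\<^esub>"
      using inj_on_eq_iff[OF frac(3) coset_closed[OF that] S.zero_closed] by (simp add: \<theta>_def)
    then show ?thesis
      using coset_zero[OF that] by simp
  qed
  interpret quantum_weyl_fractions n r \<Lambda> D \<theta>
  proof
    fix p q :: "generator list \<Rightarrow>\<^sub>0 'k"
    assume p: "Poly_Mapping.keys p \<subseteq> lists (S_gens n r)"
    then show "\<theta> p \<in> carrier D" "\<theta> p = \<zero>\<^bsub>D\<^esub> \<longleftrightarrow> p \<in> ?I"
      using ring_hom_memE(1)[OF hom] zero carrier_A by auto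
    assume q: "Poly_Mapping.keys q \<subseteq> lists (S_gens n r)"
    show "\<theta> (p + q) = \<theta> p \<oplus>\<^bsub>D\<^esub> \<theta> q" "\<theta> (p * q) = \<theta> p \<otimes>\<^bsub>D\<^esub> \<theta> q"
      using ring_hom_memE(2,3)[OF hom] p q by (simp_all add: free_algebra_def)
  next
    show "\<theta> 1 = \<one>\<^bsub>D\<^esub>"
      using ring_hom_memE(4)[OF hom] by (simp add: free_algebra_def)
  next
    fix d assume "d \<in> carrier D"
    then obtain a b where ab: "a \<in> carrier (S_alg n r \<Lambda>)" "b \<in> carrier (S_alg n r \<Lambda>)" "b \<noteq> \<zero>\<^bsub>S_alg n r \<Lambda>\<^esub>"
      "d = \<iota> a \<otimes>\<^bsub>D\<^esub> inv\<^bsub>D\<^esub> (\<iota> b)"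
      using frac(4) by blast
    obtain p q where "p \<in> carrier ?A" "q \<in> carrier ?A" "a = ?I +>\<^bsub>?A\<^esub> p" "b = ?I +>\<^bsub>?A\<^esub> q"
      using coset_cases ab by meson
    then show "\<exists>a b. Poly_Mapping.keys a \<subseteq> lists (S_gens n r) \<and> Poly_Mapping.keys b \<subseteq> lists (S_gens n r) \<and> b \<notin> ?I
        \<and> d = \<theta> a \<otimes>\<^bsub>D\<^esub> inv\<^bsub>D\<^esub> \<theta> b"
      using ab coset_zero carrier_A by (intro exI[of _ p] exI[of _ q]) (auto simp: \<theta>_def)
  qed (use assms frac(1) in auto)
  have eta: "\<iota> \<circ> S_scalar n r \<Lambda> = \<eta>"
    by (simp add: fun_eq_iff S_scalar_def \<eta>_def \<theta>_def scalar_def)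
  show ?thesis
    unfolding eta L_def[symmetric] using G_trace_eq E_trace_eq_UNIV E_trace_eq_zero by blast
qed

end
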